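(* Let $G$ be a non-abelian group of order $16$. Then $G$ is a t-group if and only if $G$ is isomorphic either to the dihedral group $D_{16}$ of order $16$ or to the dicyclic group $Q_{16}=\langle a,b\mid a^{8}=1,\ a^4b^2=1,\ abab^{-1}=1\rangle$ of order $16$.
   Context: All groups are finite. Let $G$ be a finite group and $H\le G$. A normalized right transversal (NRT) of $H$ in $G$ is a subset $S\subseteq G$ containing exactly one element from each right coset of $H$ in $G$ and with $1\in S$. $\mathcal{T}(G,H)$ denotes the set of all NRTs of $H$ in $G$. Each NRT $S$ carries the binary operation $\circ$ defined by $\{x\circ y\}=S\cap Hxy$, which makes $S$ a right loop with identity $1$. Two NRTs (possibly of different subgroups) are isomorphic, written $S_1\cong S_2$, if there is a bijection between them preserving these operations. For a divisor $d$ of $|G|$, the transiso graph $\Gamma_d(G)$ is the simple graph whose vertices are the subgroups of $G$ of order $d$, two distinct vertices $H_1,H_2$ being adjacent if and only if there exist $S_1\in\mathcal{T}(G,H_1)$ and $S_2\in\mathcal{T}(G,H_2)$ with $S_1\cong S_2$. A graph is complete if any two distinct vertices are adjacent (so graphs with at most one vertex are complete). A finite group $G$ is a t-group if $\Gamma_d(G)$ is complete for every divisor $d$ of $|G|$. *)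

theory Defs
  imports "HOL-Algebra.Algebra" "Graph_Theory.Kuratowski"
begin

section \<open>Normalized right transversals\<close>

definition NRT :: "('a, 'b) monoid_scheme \<Rightarrow> 'a set \<Rightarrow> 'a set set" where
  "NRT G H = {S. S \<subseteq> carrier G \<and> \<one>\<^bsub>G\<^esub> \<in> S \<and>
                 (\<forall>C \<in> rcosets\<^bsub>G\<^esub> H. \<exists>!s. s \<in> S \<inter> C)}"

text \<open>
  The right loop carried by a transversal. It is packaged as a \<open>monoid\<close> record, whose
  operation need not be associative, so that the library relation \<open>\<cong>\<close> (existence of a
  bijection preserving the operation) applies to it. The description of its operation is
  well defined for \<open>S \<in> NRT G H\<close>, \<open>x \<in> S\<close> and \<open>y \<in> S\<close>.
\<close>

definition right_loop :: "('a, 'b) monoid_scheme \<Rightarrow> 'a set \<Rightarrow> 'a set \<Rightarrow> 'a monoid" where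
  "right_loop G H S =
     \<lparr>carrier = S,
      monoid.mult = (\<lambda>x y. THE z. z \<in> S \<inter> (H #>\<^bsub>G\<^esub> (x \<otimes>\<^bsub>G\<^esub> y))),
      one = \<one>\<^bsub>G\<^esub>\<rparr>"


section \<open>Transiso graphs and t-groups\<close>

text \<open>A simple graph is a loopless symmetric \<open>pair_pre_digraph\<close>: each edge is stored
  as its two ordered pairs.\<close>

definition transiso_graph :: "nat \<Rightarrow> ('a, 'b) monoid_scheme \<Rightarrow> 'a set pair_pre_digraph" where
  "transiso_graph d G =
     \<lparr>pverts = {H. subgroup H G \<and> card H = d},
      parcs = {(H\<^sub>1, H\<^sub>2). subgroup H\<^sub>1 G \<and> card H\<^sub>1 = d \<and> subgroup H\<^sub>2 G \<and> card H\<^sub>2 = d \<and>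
                 H\<^sub>1 \<noteq> H\<^sub>2 \<and>
                 (\<exists>S\<^sub>1 \<in> NRT G H\<^sub>1. \<exists>S\<^sub>2 \<in> NRT G H\<^sub>2.
                    right_loop G H\<^sub>1 S\<^sub>1 \<cong> right_loop G H\<^sub>2 S\<^sub>2)}\<rparr>"

text \<open>\<open>complete_digraph n\<close> says that the graph is complete on exactly \<open>n\<close> vertices.\<close>

definition t_group :: "('a, 'b) monoid_scheme \<Rightarrow> bool" where
  "t_group G \<longleftrightarrow> group G \<and> finite (carrier G) \<and>
     (\<forall>d. d dvd order G \<longrightarrow>
        complete_digraph (card (pverts (transiso_graph d G))) (with_proj (transiso_graph d G)))"


section \<open>Groups given by generators and relators\<close>

text \<open>The letter \<open>(x, True)\<close> is the generator \<open>x\<close>, and \<open>(x, False)\<close> its formal inverse.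
  The generators are all the elements of the type \<open>'g\<close>.\<close>

type_synonym 'g word = "('g \<times> bool) list"

inductive_set pres_rel :: "'g word set \<Rightarrow> ('g word \<times> 'g word) set" for R where
  refl: "(u, u) \<in> pres_rel R"
| sym: "(u, v) \<in> pres_rel R \<Longrightarrow> (v, u) \<in> pres_rel R"
| trans: "(u, v) \<in> pres_rel R \<Longrightarrow> (v, w) \<in> pres_rel R \<Longrightarrow> (u, w) \<in> pres_rel R"
| cancel: "(u @ [(x, e), (x, \<not> e)] @ v, u @ v) \<in> pres_rel R"
| relator: "r \<in> R \<Longrightarrow> (u @ r @ v, u @ v) \<in> pres_rel R"

definition presented_group :: "'g word set \<Rightarrow> 'g word set monoid" where
  "presented_group R =
     \<lparr>carrier = UNIV // pres_rel R,
      monoid.mult = (\<lambda>A B. \<Union>u\<in>A. \<Union>v\<in>B. pres_rel R `` {u @ v}),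
      one = pres_rel R `` {[]}\<rparr>"

definition wpow :: "'g word \<Rightarrow> nat \<Rightarrow> 'g word" where
  "wpow w n = concat (replicate n w)"

datatype gen = Gen_a | Gen_b

abbreviation wa :: "gen word" where "wa \<equiv> [(Gen_a, True)]"
abbreviation wb :: "gen word" where "wb \<equiv> [(Gen_b, True)]"
abbreviation wb_inv :: "gen word" where "wb_inv \<equiv> [(Gen_b, False)]"

definition D16 :: "gen word set monoid" where
  "D16 = presented_group {wpow wa 8, wpow wb 2, wa @ wb @ wa @ wb_inv}"

definition Q16 :: "gen word set monoid" where
  "Q16 = presented_group {wpow wa 8, wpow wa 4 @ wpow wb 2, wa @ wb @ wa @ wb_inv}"

end

theory Submission
  imports Defs
begin

text \<open>
  Loops on transversals of a normal subgroup \<open>N\<close> are copies of \<open>G/N\<close>. If \<open>H\<close> has trivial core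
  and the loop on a transversal \<open>S\<close> of \<open>H\<close> is a group, then \<open>S\<close> is a complement of \<open>H\<close>. Hence, in
  a t-group of order 16 with a central involution \<open>z\<close>, every subgroup generated by a noncentral
  involution has a complement isomorphic to \<open>G/\<langle>z\<rangle>\<close>, and \<open>G/\<langle>z\<rangle> \<cong> G/\<langle>u\<rangle>\<close> for any other central
  involution \<open>u\<close>.

  A non-abelian group of order 16 and exponent 4 has a derived subgroup \<open>\<langle>u\<rangle>\<close> of order 2. For a
  t-group, \<open>u\<close> is then the only central involution, squares lie in \<open>\<langle>u\<rangle>\<close>, the centre is cyclic of
  order 4, and there is a noncentral involution; its complement is elementary abelian of order 8
  and generates \<open>G\<close> together with the centre, so \<open>G\<close> would be abelian. Hence \<open>G\<close> contains \<open>a\<close> of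
  order 8 and \<open>b a b\<^sup>-\<^sup>1 = a\<^sup>r\<close> for some \<open>b\<close> outside \<open>\<langle>a\<rangle>\<close>. For \<open>r = 3, 5\<close> there is a noncentral involution
  whose complements contain one involution only, whereas \<open>G/\<langle>a\<^sup>4\<rangle>\<close> contains several.
  Thus \<open>r = 7\<close>, and \<open>G\<close> is dihedral or dicyclic.

  In these two groups all subgroups of order 8, 4 and 2 admit, respectively, the group of order 2,
  the Klein four-group, and, for the dihedral group, the dihedral group of order 8 as a loop on a
  transversal.
\<close>

section \<open>Transversals and their right loops\<close>

context group begin

lemma mult_inv_cancel_left:
  "x \<in> carrier G \<Longrightarrow> y \<in> carrier G \<Longrightarrow> x \<otimes> (inv x \<otimes> y) = y"
  "x \<in> carrier G \<Longrightarrow> y \<in> carrier G \<Longrightarrow> inv x \<otimes> (x \<otimes> y) = y"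
  by (simp_all flip: m_assoc)

text \<open>Cosets are traded for membership in \<open>H\<close>, since \<open>s\<close> lies in
  \<open>H #> g\<close> exactly when \<open>s \<otimes> inv g\<close> lies in \<open>H\<close>.
  Later computations with transversals use this form.\<close>

lemma NRT_iff:
  assumes "subgroup H G"
  shows "S \<in> NRT G H \<longleftrightarrow> S \<subseteq> carrier G \<and> \<one> \<in> S \<and>
    (\<forall>g \<in> carrier G. \<exists>!s. s \<in> S \<and> s \<otimes> inv g \<in> H)"
proof -
  interpret H: subgroup H G by fact
  have "s \<in> S \<inter> (H #> g) \<longleftrightarrow> s \<in> S \<and> s \<otimes> inv g \<in> H"
    if "S \<subseteq> carrier G" "g \<in> carrier G" for s g
    using that H.rcos_module[OF is_group] by auto
  then show ?thesis
    unfolding NRT_def RCOSETS_def by (auto cong: conj_cong)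
qed

lemma NRT_D:
  assumes "subgroup H G" "S \<in> NRT G H"
  shows NRT_subset: "S \<subseteq> carrier G" and NRT_one: "\<one> \<in> S"
    and NRT_ex: "\<And>g. g \<in> carrier G \<Longrightarrow> \<exists>s. s \<in> S \<and> s \<otimes> inv g \<in> H"
    and NRT_unique: "\<And>g s t. \<lbrakk>g \<in> carrier G; s \<in> S; t \<in> S; s \<otimes> inv g \<in> H; t \<otimes> inv g \<in> H\<rbrakk> \<Longrightarrow> s = t"
  using assms(2) unfolding NRT_iff[OF assms(1)] by blast+

lemma rcos_eq_iff:
  assumes "subgroup H G" "s \<in> carrier G" "t \<in> carrier G"
  shows "H #> s = H #> t \<longleftrightarrow> s \<otimes> inv t \<in> H"
proof -
  interpret H: subgroup H G by fact
  have "H #> s = H #> t \<longleftrightarrow> s \<in> H #> t"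
    using repr_independence[OF _ assms(3,1)] rcos_self[OF assms(2,1)] by blast
  then show ?thesis using H.rcos_module[OF is_group assms(3,2)] by simp
qed

lemma NRT_rcosets:
  assumes "subgroup H G" "S \<in> NRT G H"
  shows "(\<lambda>s. H #> s) ` S = (\<lambda>s. H #> s) ` carrier G"
proof
  show "(\<lambda>s. H #> s) ` carrier G \<subseteq> (\<lambda>s. H #> s) ` S"
  proof (rule image_subsetI)
    fix g assume g: "g \<in> carrier G"
    then obtain s where s: "s \<in> S" "s \<otimes> inv g \<in> H" using NRT_ex[OF assms] by blast
    then have "H #> g = H #> s"
      using NRT_subset[OF assms] g by (subst eq_commute, subst rcos_eq_iff[OF assms(1)]) auto
    then show "H #> g \<in> (\<lambda>s. H #> s) ` S" using s(1) by blast
  qed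
qed (use NRT_subset[OF assms] in blast)

text \<open>Uniqueness of the representative resolves the \<open>THE\<close> in
  \<open>right_loop\<close> once and for all. Afterwards a loop product is identified by exhibiting
  an element of \<open>S\<close> in the coset of \<open>x \<otimes> y\<close>.\<close>

lemma right_loop_mult:
  assumes "subgroup H G" "S \<in> NRT G H" "x \<in> S" "y \<in> S"
  shows right_loop_closed: "x \<otimes>\<^bsub>right_loop G H S\<^esub> y \<in> S"
    and right_loop_mem: "(x \<otimes>\<^bsub>right_loop G H S\<^esub> y) \<otimes> inv (x \<otimes> y) \<in> H"
    and right_loop_eqI: "\<And>z. z \<in> S \<Longrightarrow> z \<otimes> inv (x \<otimes> y) \<in> H \<Longrightarrow> x \<otimes>\<^bsub>right_loop G H S\<^esub> y = z"
proof -
  interpret H: subgroup H G by fact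
  have xy: "x \<otimes> y \<in> carrier G" using assms NRT_subset by blast
  have iff: "z \<in> S \<inter> (H #> (x \<otimes> y)) \<longleftrightarrow> z \<in> S \<and> z \<otimes> inv (x \<otimes> y) \<in> H" for z
    using H.rcos_module[OF is_group xy] NRT_subset[OF assms(1,2)] by auto
  have "\<exists>!z. z \<in> S \<inter> (H #> (x \<otimes> y))"
    unfolding iff using assms(2) xy unfolding NRT_iff[OF assms(1)] by blast
  moreover have m: "x \<otimes>\<^bsub>right_loop G H S\<^esub> y = (THE z. z \<in> S \<inter> (H #> (x \<otimes> y)))"
    by (simp add: right_loop_def)
  ultimately show "x \<otimes>\<^bsub>right_loop G H S\<^esub> y \<in> S" "(x \<otimes>\<^bsub>right_loop G H S\<^esub> y) \<otimes> inv (x \<otimes> y) \<in> H"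
    "\<And>z. z \<in> S \<Longrightarrow> z \<otimes> inv (x \<otimes> y) \<in> H \<Longrightarrow> x \<otimes>\<^bsub>right_loop G H S\<^esub> y = z"
    unfolding m using theI'[of "\<lambda>z. z \<in> S \<inter> (H #> (x \<otimes> y))"]
      the1_equality[of "\<lambda>z. z \<in> S \<inter> (H #> (x \<otimes> y))"] unfolding iff by blast+
qed

lemma carrier_right_loop [simp]: "carrier (right_loop G H S) = S"
  by (simp add: right_loop_def)

text \<open>The loop product lies in the coset of the product in \<open>G\<close>, and for normal
  \<open>N\<close> cosets multiply like their representatives. Each coset contains exactly one
  element of \<open>S\<close>, which gives bijectivity.\<close>

lemma right_loop_normal_iso:
  assumes "N \<lhd> G" "S \<in> NRT G N"
  shows "(\<lambda>s. N #> s) \<in> iso (right_loop G N S) (G Mod N)"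
proof -
  interpret N: normal N G by fact
  have sub: "subgroup N G" using N.subgroup_axioms .
  note S = NRT_D[OF sub assms(2)]
  note eq = rcos_eq_iff[OF sub]
  show ?thesis
  proof (rule isoI)
    show "(\<lambda>s. N #> s) \<in> hom (right_loop G N S) (G Mod N)"
    proof (rule homI)
      fix x y assume "x \<in> carrier (right_loop G N S)" "y \<in> carrier (right_loop G N S)"
      then have xy: "x \<in> S" "y \<in> S" by auto
      have "N #> (x \<otimes>\<^bsub>right_loop G N S\<^esub> y) = N #> (x \<otimes> y)"
        using right_loop_closed[OF sub assms(2) xy] right_loop_mem[OF sub assms(2) xy] xy S(1)
        by (subst eq) auto
      also have "\<dots> = (N #> x) <#> (N #> y)"
        using xy S(1) by (simp add: N.rcos_sum subsetD)
      finally show "N #> (x \<otimes>\<^bsub>right_loop G N S\<^esub> y) = (N #> x) \<otimes>\<^bsub>G Mod N\<^esub> (N #> y)"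
        by simp
    qed (use S(1) in \<open>auto simp: carrier_FactGroup\<close>)
    show "bij_betw (\<lambda>s. N #> s) (carrier (right_loop G N S)) (carrier (G Mod N))"
      unfolding bij_betw_def
    proof
      show "inj_on (\<lambda>s. N #> s) (carrier (right_loop G N S))"
      proof (rule inj_onI)
        fix s t assume st: "s \<in> carrier (right_loop G N S)" "t \<in> carrier (right_loop G N S)"
          and "N #> s = N #> t"
        then have "s \<otimes> inv t \<in> N" "t \<otimes> inv t \<in> N" "t \<in> carrier G"
          using eq S(1) N.one_closed by auto
        then show "s = t" using S(4) st by auto
      qed
      show "(\<lambda>s. N #> s) ` carrier (right_loop G N S) = carrier (G Mod N)"
        unfolding carrier_FactGroup carrier_right_loop by (rule NRT_rcosets[OF sub assms(2)])
    qed
  qed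
qed

lemma card_NRT:
  assumes "finite (carrier G)" "subgroup H G" "S \<in> NRT G H"
  shows "card S * card H = order G"
proof -
  interpret H: subgroup H G by fact
  note S = NRT_D[OF assms(2,3)]
  note eq = rcos_eq_iff[OF assms(2)]
  have "bij_betw (\<lambda>s. H #> s) S (rcosets H)"
    unfolding bij_betw_def
  proof
    show "inj_on (\<lambda>s. H #> s) S"
    proof (rule inj_onI)
      fix s t assume st: "s \<in> S" "t \<in> S" and "H #> s = H #> t"
      then have "s \<otimes> inv t \<in> H" "t \<otimes> inv t \<in> H" "t \<in> carrier G"
        using eq S(1) H.one_closed by auto
      then show "s = t" using S(4) st by auto
    qed
    show "(\<lambda>s. H #> s) ` S = rcosets H"
      unfolding NRT_rcosets[OF assms(2,3)] by (auto simp: RCOSETS_def)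
  qed
  then show ?thesis using lagrange_finite[OF assms(1,2)] bij_betw_same_card by metis
qed

text \<open>The discrepancy between the two products of \<open>x\<close> and \<open>y\<close> lies in every conjugate
  of \<open>H\<close>.\<close>

lemma right_loop_assoc_mult:
  assumes H: "subgroup H G" and S: "S \<in> NRT G H"
    and assoc: "\<And>x y z. \<lbrakk>x \<in> S; y \<in> S; z \<in> S\<rbrakk> \<Longrightarrow>
      (x \<otimes>\<^bsub>right_loop G H S\<^esub> y) \<otimes>\<^bsub>right_loop G H S\<^esub> z =
      x \<otimes>\<^bsub>right_loop G H S\<^esub> (y \<otimes>\<^bsub>right_loop G H S\<^esub> z)"
    and core: "\<And>h. \<lbrakk>h \<in> H; \<And>g. g \<in> carrier G \<Longrightarrow> g \<otimes> h \<otimes> inv g \<in> H\<rbrakk> \<Longrightarrow> h = \<one>"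
    and xy: "x \<in> S" "y \<in> S"
  shows "x \<otimes>\<^bsub>right_loop G H S\<^esub> y = x \<otimes> y"
proof -
  interpret H: subgroup H G by fact
  let ?m = "monoid.mult (right_loop G H S)"
  note D = NRT_D[OF H S] and cl = right_loop_closed[OF H S] and mem = right_loop_mem[OF H S]
  have car: "s \<in> carrier G" if "s \<in> S" for s using D(1) that by blast
  have [simp]: "x \<in> carrier G" "y \<in> carrier G" "?m x y \<in> carrier G" using car xy cl by auto
  define h where "h = ?m x y \<otimes> inv (x \<otimes> y)"
  have h: "h \<in> H" unfolding h_def using mem[OF xy] .
  then have hc [simp]: "h \<in> carrier G" by (rule H.mem_carrier)
  \<comment> \<open>By associativity \<open>?u\<close> is both loop products of s, x, y, so it lies
    in the coset of \<open>s \<otimes> x \<otimes> y\<close> and in that of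
    \<open>s \<otimes> h \<otimes> x \<otimes> y\<close>. Comparing the two puts the conjugate of
    \<open>h\<close> by \<open>s\<close> into \<open>H\<close>.\<close>
  have S_conj: "s \<otimes> h \<otimes> inv s \<in> H" if s: "s \<in> S" for s
  proof -
    let ?u = "?m s (?m x y)"
    have c [simp]: "s \<in> carrier G" "?m s x \<in> carrier G" "?u \<in> carrier G"
      using car s xy cl by auto
    have 1: "?u \<otimes> inv (s \<otimes> ?m x y) \<in> H" using mem[OF s] cl xy by blast
    have 2: "?u \<otimes> inv (?m s x \<otimes> y) \<in> H"
      using mem[OF cl[OF s xy(1)] xy(2)] assoc[OF s xy] by simp
    have 3: "?m s x \<otimes> inv (s \<otimes> x) \<in> H" using mem s xy by blast
    have "inv (?u \<otimes> inv (s \<otimes> ?m x y)) \<otimes> ((?u \<otimes> inv (?m s x \<otimes> y)) \<otimes> (?m s x \<otimes> inv (s \<otimes> x))) \<in> H"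
      using 1 2 3 by simp
    also have "inv (?u \<otimes> inv (s \<otimes> ?m x y)) \<otimes> ((?u \<otimes> inv (?m s x \<otimes> y)) \<otimes> (?m s x \<otimes> inv (s \<otimes> x)))
      = s \<otimes> h \<otimes> inv s"
      by (simp add: h_def m_assoc inv_mult_group mult_inv_cancel_left)
    finally show ?thesis .
  qed
  \<comment> \<open>An arbitrary \<open>g\<close> differs from some \<open>s\<close> in
    \<open>S\<close> by a left factor in \<open>H\<close>, and conjugation by that factor preserves
    \<open>H\<close>.\<close>
  have "g \<otimes> h \<otimes> inv g \<in> H" if g: "g \<in> carrier G" for g
  proof -
    obtain s where s: "s \<in> S" "s \<otimes> inv g \<in> H" using D(3)[OF g] by blast
    have [simp]: "s \<in> carrier G" using s car by auto
    have "inv (s \<otimes> inv g) \<otimes> (s \<otimes> h \<otimes> inv s) \<otimes> (s \<otimes> inv g) \<in> H"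
      using s S_conj by simp
    also have "inv (s \<otimes> inv g) \<otimes> (s \<otimes> h \<otimes> inv s) \<otimes> (s \<otimes> inv g) = g \<otimes> h \<otimes> inv g"
      using g by (simp add: m_assoc inv_mult_group mult_inv_cancel_left)
    finally show ?thesis .
  qed
  then have "h = \<one>" using core h by blast
  then show ?thesis unfolding h_def by (metis \<open>?m x y \<in> carrier G\<close> \<open>x \<in> carrier G\<close> \<open>y \<in> carrier G\<close> inv_closed inv_equality inv_inv m_closed)
qed

end

text \<open>Lagrange's theorem absorbs the divisor \<open>d\<close> into the equality of the two
  cardinalities. Finiteness of the vertex set, which is part of completeness, follows from that of
  \<open>G\<close>.\<close>

lemma t_group_iff:
  "t_group G \<longleftrightarrow> group G \<and> finite (carrier G) \<and>
    (\<forall>H K. subgroup H G \<and> subgroup K G \<and> card H = card K \<and> H \<noteq> K \<longrightarrow>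
      (\<exists>S \<in> NRT G H. \<exists>T \<in> NRT G K. right_loop G H S \<cong> right_loop G K T))"
proof -
  let ?adj = "\<lambda>H K. \<exists>S \<in> NRT G H. \<exists>T \<in> NRT G K. right_loop G H S \<cong> right_loop G K T"
  have complete: "complete_digraph (card (pverts (transiso_graph d G))) (with_proj (transiso_graph d G)) \<longleftrightarrow>
    (\<forall>H K. subgroup H G \<and> subgroup K G \<and> card H = d \<and> card K = d \<and> H \<noteq> K \<longrightarrow> ?adj H K)"
    if "finite (carrier G)" for d
  proof -
    have fin: "finite {H. subgroup H G \<and> card H = d}"
      by (rule finite_subset[of _ "Pow (carrier G)"]) (use that in \<open>auto dest: subgroup.subset\<close>)
    show ?thesis
      unfolding complete_digraph_pair_def transiso_graph_def pair_pre_digraph.simps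
      using fin by (simp only: set_eq_iff split_paired_All mem_Collect_eq prod.case mem_Sigma_iff) blast
  qed
  have dvd: "card H dvd order G" if "group G" "finite (carrier G)" "subgroup H G" for H
    using group.lagrange_finite[OF that] by (metis dvd_triv_right)
  show ?thesis
  proof (cases "group G \<and> finite (carrier G)")
    case True
    then show ?thesis using dvd unfolding t_group_def by (simp add: complete) metis
  qed (auto simp: t_group_def)
qed

context group begin

section \<open>Central involutions and t-groups\<close>

definition central_involution :: "'a \<Rightarrow> bool" where
  "central_involution z \<longleftrightarrow> z \<in> carrier G \<and> z \<noteq> \<one> \<and> z \<otimes> z = \<one> \<and> (\<forall>g \<in> carrier G. z \<otimes> g = g \<otimes> z)"

text \<open>For a central involution \<open>u\<close> this says that the images of \<open>g\<close>
  and \<open>h\<close> commute in the quotient by {1, u}, without forming that quotient.\<close>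

definition commute_mod :: "'a \<Rightarrow> 'a \<Rightarrow> 'a \<Rightarrow> bool" where
  "commute_mod u g h \<longleftrightarrow> g \<otimes> h = h \<otimes> g \<or> g \<otimes> h = h \<otimes> g \<otimes> u"

definition centralizer :: "'a \<Rightarrow> 'a set" where
  "centralizer h = {g \<in> carrier G. g \<otimes> h = h \<otimes> g}"

lemma central_involutionD:
  assumes "central_involution z"
  shows "z \<in> carrier G" "z \<noteq> \<one>" "z \<otimes> z = \<one>"
    "\<And>g. g \<in> carrier G \<Longrightarrow> z \<otimes> g = g \<otimes> z"
    "\<And>g h. \<lbrakk>g \<in> carrier G; h \<in> carrier G\<rbrakk> \<Longrightarrow> z \<otimes> (g \<otimes> h) = g \<otimes> (z \<otimes> h)"
    "\<And>h. h \<in> carrier G \<Longrightarrow> z \<otimes> (z \<otimes> h) = h"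
proof -
  show z: "z \<in> carrier G" "z \<noteq> \<one>" "z \<otimes> z = \<one>" and c: "\<And>g. g \<in> carrier G \<Longrightarrow> z \<otimes> g = g \<otimes> z"
    using assms unfolding central_involution_def by auto
  show "z \<otimes> (g \<otimes> h) = g \<otimes> (z \<otimes> h)" if "g \<in> carrier G" "h \<in> carrier G" for g h
    using that z m_assoc[of z g h] m_assoc[of g z h] c[of g] by simp
  show "z \<otimes> (z \<otimes> h) = h" if "h \<in> carrier G" for h
    using that z m_assoc[of z z h] by simp
qed

text \<open>Makes a product equation usable as a rewrite rule inside right-nested products, the form
  produced by \<open>m_assoc\<close>.\<close>

lemma mult_eq_extend:
  "a \<otimes> b = c \<Longrightarrow> \<lbrakk>a \<in> carrier G; b \<in> carrier G; k \<in> carrier G\<rbrakk> \<Longrightarrow> a \<otimes> (b \<otimes> k) = c \<otimes> k"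
  by (simp flip: m_assoc)

lemma subgroup_pair:
  assumes "t \<in> carrier G" "t \<otimes> t = \<one>"
  shows "subgroup {\<one>, t} G"
proof -
  have "inv t = t" using assms by (simp add: inv_equality)
  then show ?thesis using assms by (intro subgroupI) auto
qed

lemma normal_pair:
  assumes "central_involution z"
  shows "{\<one>, z} \<lhd> G"
proof -
  note z = central_involutionD[OF assms]
  have "x \<otimes> z \<otimes> inv x = z" if "x \<in> carrier G" for x
    using that z(1) z(4)[OF that, symmetric] by (simp add: m_assoc)
  then show ?thesis unfolding normal_inv_iff using subgroup_pair[OF z(1,3)] by auto
qed

lemma rcos_pair_eq_iff:
  assumes z: "central_involution z" and gh: "g \<in> carrier G" "h \<in> carrier G"
  shows "{\<one>, z} #> g = {\<one>, z} #> h \<longleftrightarrow> g = h \<or> g = h \<otimes> z"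
proof -
  note z = central_involutionD[OF z]
  have "{\<one>, z} #> g = {\<one>, z} #> h \<longleftrightarrow> g \<otimes> inv h \<in> {\<one>, z}"
    using rcos_eq_iff[OF subgroup_pair[OF z(1,3)] gh] .
  also have "\<dots> \<longleftrightarrow> \<one> = g \<otimes> inv h \<or> z = g \<otimes> inv h" by auto
  also have "\<dots> \<longleftrightarrow> g = h \<or> g = h \<otimes> z"
    using inv_solve_right[of \<one> g h] inv_solve_right[of z g h] gh z(1) z(4)[OF gh(2)] by auto
  finally show ?thesis .
qed

lemma centralizer_subgroup: "h \<in> carrier G \<Longrightarrow> subgroup (centralizer h) G"
proof (rule subgroupI)
  assume h: "h \<in> carrier G"
  show "centralizer h \<noteq> {}" using h by (auto simp: centralizer_def intro!: exI[of _ \<one>])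
  fix a assume a: "a \<in> centralizer h"
  then have ac: "a \<in> carrier G" "a \<otimes> h = h \<otimes> a" by (auto simp: centralizer_def)
  have "inv a \<otimes> h = inv a \<otimes> (h \<otimes> a) \<otimes> inv a" using ac h by (simp add: m_assoc)
  also have "\<dots> = h \<otimes> inv a" using ac h by (simp flip: ac(2)) (simp flip: m_assoc)
  finally show "inv a \<in> centralizer h" using ac by (simp add: centralizer_def)
  fix b assume "b \<in> centralizer h"
  then have bc: "b \<in> carrier G" "b \<otimes> h = h \<otimes> b" by (auto simp: centralizer_def)
  show "a \<otimes> b \<in> centralizer h"
    using ac bc h mult_eq_extend[OF ac(2)] by (simp add: centralizer_def m_assoc)
qed (auto simp: centralizer_def)

text \<open>This set is the preimage, under the quotient map modulo {1, u}, of the centralizer of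
  the coset of \<open>h\<close>.\<close>

lemma commute_mod_subgroup:
  assumes u: "central_involution u" and h: "h \<in> carrier G"
  shows "subgroup {g \<in> carrier G. commute_mod u g h} G"
proof -
  have coset_eq: "commute_mod u g h \<longleftrightarrow> {\<one>, u} #> (g \<otimes> h) = {\<one>, u} #> (h \<otimes> g)" if "g \<in> carrier G" for g
    using rcos_pair_eq_iff[OF u] that h by (simp add: commute_mod_def)
  interpret N: normal "{\<one>, u}" G using normal_pair[OF u] .
  interpret Q: group "G Mod {\<one>, u}" by (rule N.factorgroup_is_group)
  interpret q: group_hom G "G Mod {\<one>, u}" "\<lambda>g. {\<one>, u} #> g"
    by (unfold_locales) (rule N.r_coset_hom_Mod)
  have eq: "commute_mod u g h \<longleftrightarrow> {\<one>, u} #> g \<in> Q.centralizer ({\<one>, u} #> h)" if "g \<in> carrier G" for g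
    using that h q.hom_closed[OF that] q.hom_mult[OF that h] q.hom_mult[OF h that] unfolding coset_eq[OF that] Q.centralizer_def by simp
  interpret C: subgroup "Q.centralizer ({\<one>, u} #> h)" "G Mod {\<one>, u}"
    using Q.centralizer_subgroup q.hom_closed[OF h] .
  show ?thesis
  proof (rule subgroupI)
    show "{g \<in> carrier G. commute_mod u g h} \<noteq> {}"
      using h by (auto simp: commute_mod_def intro!: exI[of _ \<one>])
    fix a assume "a \<in> {g \<in> carrier G. commute_mod u g h}"
    then have a: "a \<in> carrier G" "{\<one>, u} #> a \<in> Q.centralizer ({\<one>, u} #> h)" using eq by auto
    show "inv a \<in> {g \<in> carrier G. commute_mod u g h}"
      using a C.m_inv_closed[OF a(2)] q.hom_inv[OF a(1)] eq[OF inv_closed[OF a(1)]] by auto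
    fix b assume "b \<in> {g \<in> carrier G. commute_mod u g h}"
    then have b: "b \<in> carrier G" "{\<one>, u} #> b \<in> Q.centralizer ({\<one>, u} #> h)" using eq by auto
    show "a \<otimes> b \<in> {g \<in> carrier G. commute_mod u g h}"
      using a b C.m_closed[OF a(2) b(2)] q.hom_mult[OF a(1) b(1)] eq[OF m_closed[OF a(1) b(1)]] by auto
  qed auto
qed

lemma commute_mod_sym:
  assumes u: "central_involution u" and gh: "g \<in> carrier G" "h \<in> carrier G" "commute_mod u g h"
  shows "commute_mod u h g"
proof -
  have "h \<otimes> g = h \<otimes> g \<otimes> u \<otimes> u"
    using central_involutionD(1,3)[OF u] gh(1,2) by (simp add: m_assoc)
  then show ?thesis using gh(3) unfolding commute_mod_def by auto
qed

text \<open>\<open>A\<close> and \<open>A #> inv y\<close> are disjoint and each contains half of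
  the group, so \<open>x\<close> lies in the second.\<close>

lemma subgroup_index2_mult:
  assumes fin: "finite (carrier G)" and A: "subgroup A G" "card A * 2 = order G"
    and x: "x \<in> carrier G" "x \<notin> A" and y: "y \<in> carrier G" "y \<notin> A"
  shows "x \<otimes> y \<in> A"
proof -
  interpret A: subgroup A G by (rule A(1))
  have fA: "finite A" using finite_subset[OF A.subset fin] .
  have disj: "A \<inter> (A #> inv y) = {}"
  proof (rule ccontr)
    assume "A \<inter> (A #> inv y) \<noteq> {}"
    then obtain a b where ab: "a \<in> A" "b \<in> A" "a = b \<otimes> inv y" by (auto simp: r_coset_def)
    then have "y = inv a \<otimes> b"
      using y by (simp add: inv_mult_group m_assoc)
    moreover have "inv a \<otimes> b \<in> A" using ab by simp
    ultimately show False using y by simp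
  qed
  have "card (A #> inv y) = card A"
    using card_rcosets_equal[OF rcosetsI[OF A.subset inv_closed[OF y(1)]] A.subset] by simp
  moreover have "finite (A #> inv y)" using finite_subset[OF r_coset_subset_G[OF A.subset inv_closed[OF y(1)]] fin] .
  ultimately have "card (A \<union> (A #> inv y)) = order G"
    using disj fA A(2) by (simp add: card_Un_disjoint)
  then have "A \<union> (A #> inv y) = carrier G"
    using fin r_coset_subset_G[OF A.subset inv_closed[OF y(1)]] A.subset
    by (intro card_subset_eq) (auto simp: order_def)
  then obtain a where "a \<in> A" "x = a \<otimes> inv y" using x by (auto simp: r_coset_def)
  then show ?thesis using y by (simp add: m_assoc)
qed

text \<open>For \<open>x\<close> outside \<open>A\<close> the product of \<open>x\<close> and
  \<open>y\<close> falls into \<open>A\<close>, so \<open>x\<close> is recovered inside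
  \<open>C\<close>. This serves to show that centralizers, also those modulo \<open>u\<close>, are
  the whole group.\<close>

lemma subgroup_index2_maximal:
  assumes fin: "finite (carrier G)" and A: "subgroup A G" "card A * 2 = order G"
    and C: "subgroup C G" "A \<subseteq> C" and y: "y \<in> C" "y \<notin> A"
  shows "C = carrier G"
proof
  interpret C: subgroup C G by (rule C(1))
  show "C \<subseteq> carrier G" using C.subset .
  show "carrier G \<subseteq> C"
  proof
    fix x assume x: "x \<in> carrier G"
    show "x \<in> C"
    proof (cases "x \<in> A")
      case False
      have yc: "y \<in> carrier G" using y(1) by (rule C.mem_carrier)
      have "x \<otimes> y \<in> C" using subgroup_index2_mult[OF fin A x False yc y(2)] C(2) by blast
      then have "(x \<otimes> y) \<otimes> inv y \<in> C" using C.m_closed[OF _ C.m_inv_closed[OF y(1)]] by blast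
      then show ?thesis using x yc by (simp add: m_assoc)
    qed (use C in blast)
  qed
qed

section \<open>Consequences of completeness for normal subgroups and involutions\<close>

lemma t_group_normal_loop:
  assumes "t_group G" and N: "N \<lhd> G" and H: "subgroup H G" "card H = card N" "H \<noteq> N"
  shows "\<exists>S \<in> NRT G H. right_loop G H S \<cong> G Mod N"
proof -
  have "subgroup N G" using N by (simp add: normal_def)
  then obtain S T where "S \<in> NRT G H" "T \<in> NRT G N" "right_loop G H S \<cong> right_loop G N T"
    using assms unfolding t_group_iff by blast
  moreover have "right_loop G N T \<cong> G Mod N"
    using right_loop_normal_iso[OF N \<open>T \<in> NRT G N\<close>] by (rule is_isoI)
  ultimately show ?thesis unfolding is_iso_def using iso_set_trans by blast
qed

text \<open>A loop on a transversal of \<open>M\<close> is a copy of \<open>G Mod M\<close> because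
  \<open>M\<close> is normal, and completeness allows it to be chosen as a copy of
  \<open>G Mod N\<close>.\<close>

lemma t_group_normal_factors:
  assumes t: "t_group G" and N: "N \<lhd> G" "M \<lhd> G" "card M = card N"
  shows "G Mod N \<cong> G Mod M"
proof (cases "M = N")
  case False
  have M: "subgroup M G" using N by (simp add: normal_def)
  obtain S where S: "S \<in> NRT G M" "right_loop G M S \<cong> G Mod N"
    using t_group_normal_loop[OF t N(1) M N(3) False] by blast
  then obtain f where f: "f \<in> iso (right_loop G M S) (G Mod N)" unfolding is_iso_def by blast
  have g: "(\<lambda>s. M #> s) \<in> iso (right_loop G M S) (G Mod M)" (is "?g \<in> _")
    using right_loop_normal_iso N(2) S(1) by blast
  \<comment> \<open>Back from \<open>G Mod M\<close> to the transversal, and on to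
    \<open>G Mod N\<close>.\<close>
  let ?h = "f \<circ> inv_into S ?g"
  have bg: "bij_betw ?g S (carrier (G Mod M))" and bf: "bij_betw f S (carrier (G Mod N))"
    using f g by (auto simp: iso_def)
  have "bij_betw ?h (carrier (G Mod M)) (carrier (G Mod N))"
    using bij_betw_trans[OF bij_betw_inv_into[OF bg] bf] .
  moreover have "?h (B \<otimes>\<^bsub>G Mod M\<^esub> C) = ?h B \<otimes>\<^bsub>G Mod N\<^esub> ?h C"
    if BC: "B \<in> carrier (G Mod M)" "C \<in> carrier (G Mod M)" for B C
  proof -
    let ?x = "inv_into S ?g B" and ?y = "inv_into S ?g C"
    have xy: "?x \<in> S" "?y \<in> S" "?g ?x = B" "?g ?y = C"
      using BC bg by (auto simp: bij_betw_def inv_into_into f_inv_into_f)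
    have cl: "?x \<otimes>\<^bsub>right_loop G M S\<^esub> ?y \<in> S" using right_loop_closed[OF M S(1) xy(1,2)] .
    have "B \<otimes>\<^bsub>G Mod M\<^esub> C = ?g (?x \<otimes>\<^bsub>right_loop G M S\<^esub> ?y)"
      using g xy by (auto simp: iso_def hom_def)
    then have "inv_into S ?g (B \<otimes>\<^bsub>G Mod M\<^esub> C) = ?x \<otimes>\<^bsub>right_loop G M S\<^esub> ?y"
      using cl bg by (simp add: bij_betw_def)
    then show ?thesis using f xy by (auto simp: iso_def hom_def)
  qed
  ultimately have "?h \<in> iso (G Mod M) (G Mod N)"
    by (intro isoI homI) (auto simp: bij_betw_def)
  then show ?thesis
    using group.iso_set_sym[OF normal.factorgroup_is_group[OF N(2)]] is_isoI by blast
next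
  case True
  then show ?thesis using is_isoI[OF iso_set_refl] by blast
qed

text \<open>The assumption \<open>comm\<close> makes the quotient by {1, u} abelian, and the
  quotient by {1, v} is isomorphic to it.\<close>

lemma t_group_commute_mod:
  assumes "t_group G" and u: "central_involution u" and v: "central_involution v"
    and comm: "\<And>g h. \<lbrakk>g \<in> carrier G; h \<in> carrier G\<rbrakk> \<Longrightarrow> commute_mod u g h"
    and gh: "g \<in> carrier G" "h \<in> carrier G"
  shows "commute_mod v g h"
proof -
  interpret U: normal "{\<one>, u}" G using normal_pair[OF u] .
  interpret V: normal "{\<one>, v}" G using normal_pair[OF v] .
  have "card {\<one>, v} = card {\<one>, u}" using central_involutionD(2)[OF u] central_involutionD(2)[OF v] by auto
  then have iso: "G Mod {\<one>, u} \<cong> G Mod {\<one>, v}"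
    using t_group_normal_factors[OF assms(1) U.normal_axioms V.normal_axioms] by blast
  have "comm_group (G Mod {\<one>, u})"
  proof (rule group.group_comm_groupI[OF U.factorgroup_is_group])
    fix x y assume "x \<in> carrier (G Mod {\<one>, u})" "y \<in> carrier (G Mod {\<one>, u})"
    then obtain a b where ab: "a \<in> carrier G" "b \<in> carrier G" "x = {\<one>, u} #> a" "y = {\<one>, u} #> b"
      by (auto simp: carrier_FactGroup)
    have "{\<one>, u} #> (a \<otimes> b) = {\<one>, u} #> (b \<otimes> a)"
      using comm[OF ab(1,2)] ab rcos_pair_eq_iff[OF u] by (simp add: commute_mod_def)
    then show "x \<otimes>\<^bsub>G Mod {\<one>, u}\<^esub> y = y \<otimes>\<^bsub>G Mod {\<one>, u}\<^esub> x"
      using ab by (simp add: U.rcos_sum)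
  qed
  then interpret Q: comm_group "G Mod {\<one>, v}"
    by (rule comm_group.iso_imp_comm_group[OF _ iso group.is_monoid[OF V.factorgroup_is_group]])
  have "{\<one>, v} #> g \<in> carrier (G Mod {\<one>, v})" "{\<one>, v} #> h \<in> carrier (G Mod {\<one>, v})"
    using gh by (auto simp: carrier_FactGroup)
  then have "({\<one>, v} #> g) <#> ({\<one>, v} #> h) = ({\<one>, v} #> h) <#> ({\<one>, v} #> g)"
    using Q.m_comm by (simp only: mult_FactGroup)
  then have "{\<one>, v} #> (g \<otimes> h) = {\<one>, v} #> (h \<otimes> g)"
    by (simp only: V.rcos_sum gh)
  then show ?thesis using rcos_pair_eq_iff[OF v] gh by (simp add: commute_mod_def)
qed

text \<open>The map \<open>p\<close> is the quotient map modulo {1, z} followed by an isomorphism of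
  the quotient onto a complement of {1, t}. An endomorphism of \<open>G\<close> records both at
  once: the complement is its image, the factor group is visible through its kernel.\<close>

lemma t_group_noncentral_involution:
  assumes t_group: "t_group G" and z: "central_involution z"
    and t: "t \<in> carrier G" "t \<noteq> \<one>" "t \<otimes> t = \<one>" "\<not> central_involution t"
  obtains p where "p \<in> hom G G" "t \<notin> p ` carrier G" "card (p ` carrier G) * 2 = order G"
    "\<And>g. g \<in> carrier G \<Longrightarrow> p g = \<one> \<longleftrightarrow> g = \<one> \<or> g = z"
proof -
  let ?N = "{\<one>, z}" and ?H = "{\<one>, t}"
  have fin: "finite (carrier G)" using t_group by (simp add: t_group_iff)
  note cz = central_involutionD[OF z]
  interpret N: normal ?N G using normal_pair[OF z] .
  interpret Q: group "G Mod ?N" by (rule N.factorgroup_is_group)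
  have H: "subgroup ?H G" using subgroup_pair t by blast
  have cards: "card ?H = card ?N" "card ?H = 2" using t(2) cz(2) by auto
  have "?H \<noteq> ?N" using t z by (auto simp: doubleton_eq_iff)
  then obtain S f where S: "S \<in> NRT G ?H" and f: "f \<in> iso (right_loop G ?H S) (G Mod ?N)"
    using t_group_normal_loop[OF t_group N.normal_axioms H cards(1)] unfolding is_iso_def by blast
  let ?m = "monoid.mult (right_loop G ?H S)"
  note D = NRT_D[OF H S] and cl = right_loop_closed[OF H S]
  have fmult: "f (?m x y) = f x \<otimes>\<^bsub>G Mod ?N\<^esub> f y" and fcl: "f x \<in> carrier (G Mod ?N)"
    if "x \<in> S" "y \<in> S" for x y
    using f that by (auto simp: iso_def hom_def)
  have bij: "bij_betw f S (carrier (G Mod ?N))" using f by (auto simp: iso_def)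
  have inj: "x = y" if "x \<in> S" "y \<in> S" "f x = f y" for x y
    using bij that by (auto simp: bij_betw_def inj_on_def)
  have assoc: "?m (?m a b) c = ?m a (?m b c)" if "a \<in> S" "b \<in> S" "c \<in> S" for a b c
    by (rule inj) (use that cl in \<open>simp_all add: fmult fcl Q.m_assoc del: mult_FactGroup\<close>)
  \<comment> \<open>A nontrivial element of the core of {1, t} would be \<open>t\<close>, whose
    conjugates could then only be \<open>t\<close> itself, making \<open>t\<close> central.\<close>
  have core: "h = \<one>" if h: "h \<in> ?H" and conj: "\<And>g. g \<in> carrier G \<Longrightarrow> g \<otimes> h \<otimes> inv g \<in> ?H" for h
  proof (rule ccontr)
    assume "h \<noteq> \<one>"
    then have "h = t" using h by blast
    have "t \<otimes> g = g \<otimes> t" if g: "g \<in> carrier G" for g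
    proof -
      have "g \<otimes> t \<otimes> inv g \<noteq> \<one>"
      proof
        assume "g \<otimes> t \<otimes> inv g = \<one>"
        then have "inv g \<otimes> (g \<otimes> t \<otimes> inv g) \<otimes> g = \<one>" using g by simp
        then show False using g t by (simp add: m_assoc mult_inv_cancel_left)
      qed
      then have "g \<otimes> t \<otimes> inv g = t" using conj[OF g] unfolding \<open>h = t\<close> by blast
      then have "g \<otimes> t \<otimes> inv g \<otimes> g = t \<otimes> g" by simp
      then show ?thesis using g t by (simp add: m_assoc)
    qed
    then show False using t unfolding central_involution_def by blast
  qed
  \<comment> \<open>Isomorphism with a group makes the loop associative, so \<open>S\<close>
    multiplies as in \<open>G\<close>.\<close>
  have mult: "?m x y = x \<otimes> y" if "x \<in> S" "y \<in> S" for x y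
    using right_loop_assoc_mult[OF H S assoc core that] .
  have "f \<one> \<otimes>\<^bsub>G Mod ?N\<^esub> f \<one> = f \<one>"
    using fmult[OF D(2) D(2)] mult[OF D(2) D(2)] by simp
  then have f1: "f \<one> = \<one>\<^bsub>G Mod ?N\<^esub>" using Q.l_cancel_one[OF fcl[OF D(2) D(2)] fcl[OF D(2) D(2)]] by simp
  have sub: "subgroup S G"
  proof (rule subgroupI)
    fix a assume a: "a \<in> S"
    then obtain b where b: "b \<in> S" "f b = inv\<^bsub>G Mod ?N\<^esub> (f a)"
      using bij fcl Q.inv_closed unfolding bij_betw_def by (metis image_iff)
    have "b \<otimes> a = \<one>"
      using a b D(2) f1 cl[OF b(1) a] fmult[OF b(1) a] mult[OF b(1) a] fcl[OF a a]
      by (intro inj) (auto simp del: mult_FactGroup one_FactGroup)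
    then show "inv a \<in> S" using a b D(1) by (metis inv_equality subsetD)
    show "a \<otimes> b \<in> S" if "b \<in> S" for b using cl[OF a that] mult[OF a that] by simp
  qed (use D(1,2) in auto)
  let ?K = "G\<lparr>carrier := S\<rparr>"
  interpret K: group ?K using subgroup_imp_group[OF sub] .
  have "f \<in> iso ?K (G Mod ?N)"
  proof (rule isoI, rule homI)
    show "f (x \<otimes>\<^bsub>?K\<^esub> y) = f x \<otimes>\<^bsub>G Mod ?N\<^esub> f y" if "x \<in> carrier ?K" "y \<in> carrier ?K" for x y
      using that mult[of x y] fmult[of x y] by simp
  qed (use bij fcl in auto)
  then have f': "inv_into S f \<in> iso (G Mod ?N) ?K" using K.iso_set_sym by force
  define p where "p = (inv_into S f) \<circ> (\<lambda>g. ?N #> g)"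
  have "(\<lambda>g. ?N #> g) \<in> hom G (G Mod ?N)" by (rule N.r_coset_hom_Mod)
  then have hom: "p \<in> hom G ?K"
    unfolding p_def using f' by (auto simp: iso_def intro: Group.hom_compose)
  have "p ` carrier G = inv_into S f ` carrier (G Mod ?N)"
    by (simp only: p_def image_comp carrier_FactGroup)
  also have "\<dots> = S" using f' by (simp add: iso_def bij_betw_def)
  finally have img: "p ` carrier G = S" .
  show thesis
  proof (rule that[of p])
    show "p \<in> hom G G" using hom D(1) unfolding hom_def by auto
    \<comment> \<open>\<open>t\<close> and one represent the same coset of {1, t}, and
      \<open>S\<close> already contains one.\<close>
    show "t \<notin> p ` carrier G"
      using D(4)[of \<one> t \<one>] D(2) t unfolding img by auto
    show "card (p ` carrier G) * 2 = order G"
      using card_NRT[OF fin H S] cards img by simp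
    fix g assume g: "g \<in> carrier G"
    then have gN: "?N #> g \<in> carrier (G Mod ?N)" by (auto simp: carrier_FactGroup)
    have "f (p g) = ?N #> g"
      using gN bij unfolding p_def bij_betw_def by (auto simp: f_inv_into_f)
    moreover have "p g \<in> S" using img g by blast
    ultimately have "p g = \<one> \<longleftrightarrow> ?N #> g = f \<one>" using inj D(2) by metis
    also have "\<dots> \<longleftrightarrow> ?N #> g = ?N #> \<one>"
      by (simp only: f1 one_FactGroup coset_mult_one[OF N.subset])
    also have "\<dots> \<longleftrightarrow> g = \<one> \<or> g = z" using rcos_pair_eq_iff[OF z g one_closed] l_one[OF cz(1)] by simp
    finally show "p g = \<one> \<longleftrightarrow> g = \<one> \<or> g = z" .
  qed
qed

section \<open>Exponent 4\<close>

text \<open>Every nontrivial conjugacy class has size divisible by \<open>p\<close>.\<close>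

lemma p_group_center_nontrivial:
  assumes "Factorial_Ring.prime p" "order G = p ^ n" "n > 0"
  shows "\<exists>c \<in> carrier G. c \<noteq> \<one> \<and> (\<forall>g \<in> carrier G. c \<otimes> g = g \<otimes> c)"
proof (rule ccontr)
  assume neg: "\<not> ?thesis"
  let ?conj = "\<lambda>g. \<lambda>h \<in> carrier G. g \<otimes> h \<otimes> inv g"
  interpret A: group_action G "carrier G" ?conj by (rule action_by_conjugation)
  have fin: "finite (carrier G)"
    using assms(2) prime_gt_0_nat[OF assms(1)] order_gt_0_iff_finite by simp
  let ?O = "orbits G (carrier G) ?conj"
  have fO: "finite ?O"
  proof -
    have "?O = Group_Action.orbit G ?conj ` carrier G" by (auto simp: orbits_def)
    then show ?thesis using fin by simp
  qed
  have one: "Group_Action.orbit G ?conj \<one> = {\<one>}" 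
  proof -
    have "Group_Action.orbit G ?conj \<one> \<subseteq> {\<one>}" by (auto simp: Group_Action.orbit_def)
    then show ?thesis using A.orbit_refl[OF one_closed] by blast
  qed
  have dvd: "p dvd card B" if B: "B \<in> ?O" "B \<noteq> {\<one>}" for B
  proof -
    obtain x where x: "x \<in> carrier G" "B = Group_Action.orbit G ?conj x" using B by (auto simp: orbits_def)
    then have "x \<noteq> \<one>" using B one by auto
    then obtain g where g: "g \<in> carrier G" "x \<otimes> g \<noteq> g \<otimes> x" using neg x by blast
    have "g \<otimes> x \<otimes> inv g \<noteq> x"
    proof
      assume "g \<otimes> x \<otimes> inv g = x"
      then have "g \<otimes> x \<otimes> inv g \<otimes> g = x \<otimes> g" by simp
      then show False using g x by (simp add: m_assoc)
    qed
    then have "stabilizer G ?conj x \<noteq> carrier G" using x(1) g(1) unfolding stabilizer_def by force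
    moreover have "stabilizer G ?conj x \<subseteq> carrier G" by (auto simp: stabilizer_def)
    ultimately have "card (stabilizer G ?conj x) < order G"
      using fin by (simp add: order_def psubset_card_mono psubsetI)
    then have "card B \<noteq> 1" using A.orbit_stabilizer_theorem[OF x(1)] x(2) by auto
    moreover have "card B dvd p ^ n"
      unfolding x(2) assms(2)[symmetric] A.orbit_stabilizer_theorem[OF x(1), symmetric]
      by (rule dvd_triv_left)
    ultimately show ?thesis using assms(1) divides_primepow_nat[of p "card B" n]
      by (metis dvd_refl dvd_power not_gr0 power_0)
  qed
  \<comment> \<open>With the class of one split off, the class equation makes the order congruent to
    1 modulo \<open>p\<close>.\<close>
  have "order G = (\<Sum>B\<in>?O. card B)"
    using A.disjoint_sum[OF fin, of "\<lambda>_. 1::nat"] by (simp add: order_def)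
  also have "\<dots> = card {\<one>} + (\<Sum>B\<in>?O - {{\<one>}}. card B)"
    using fO one by (intro sum.remove) (auto simp: orbits_def)
  finally have "order G = 1 + (\<Sum>B\<in>?O - {{\<one>}}. card B)" by simp
  moreover have "p dvd (\<Sum>B\<in>?O - {{\<one>}}. card B)" using dvd by (intro dvd_sum) auto
  moreover have "p dvd order G" using assms by simp
  ultimately have "p dvd 1" using dvd_add_left_iff[of p _ 1] by simp
  then show False using assms(1) by simp
qed

text \<open>For a nontrivial central element c, the last term different from one among c, c^2, c^4,
  c^8 is a central involution, because c^16 is one.\<close>

lemma exists_central_involution:
  assumes "order G = 16"
  shows "\<exists>z. central_involution z"
proof -
  obtain c where c: "c \<in> carrier G" "c \<noteq> \<one>" "\<And>g. g \<in> carrier G \<Longrightarrow> c \<otimes> g = g \<otimes> c"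
    using p_group_center_nontrivial[of 2 4] assms by auto
  have sq: "(\<forall>g \<in> carrier G. (a \<otimes> a) \<otimes> g = g \<otimes> (a \<otimes> a)) \<and> a \<otimes> a \<in> carrier G"
    if "a \<in> carrier G" "\<forall>g \<in> carrier G. a \<otimes> g = g \<otimes> a" for a
  proof (intro conjI ballI)
    fix g assume g: "g \<in> carrier G"
    then have "(a \<otimes> a) \<otimes> g = a \<otimes> (g \<otimes> a)"
      using that(1) g bspec[OF that(2) g] m_assoc[of a a g] by simp
    also have "\<dots> = (a \<otimes> g) \<otimes> a" using that(1) g by (simp add: m_assoc)
    also have "\<dots> = g \<otimes> a \<otimes> a" using bspec[OF that(2) g] by simp
    finally show "(a \<otimes> a) \<otimes> g = g \<otimes> (a \<otimes> a)" using that(1) g by (simp add: m_assoc)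
  qed (use that(1) in auto)
  define d where "d = c \<otimes> c"
  define e where "e = d \<otimes> d"
  define f where "f = e \<otimes> e"
  have d: "d \<in> carrier G" "\<forall>g \<in> carrier G. d \<otimes> g = g \<otimes> d" using sq[of c] c unfolding d_def by blast+
  have e: "e \<in> carrier G" "\<forall>g \<in> carrier G. e \<otimes> g = g \<otimes> e" using sq[OF d] unfolding e_def by blast+
  have f: "f \<in> carrier G" "\<forall>g \<in> carrier G. f \<otimes> g = g \<otimes> f" using sq[OF e] unfolding f_def by blast+
  have "c [^] (16::nat) = \<one>" using pow_order_eq_1[OF c(1)] assms by simp
  then have "f \<otimes> f = \<one>"
    using c(1) unfolding f_def e_def d_def by (simp add: numeral_eq_Suc m_assoc)
  then show ?thesis
    using c d e f unfolding central_involution_def d_def[symmetric] e_def[symmetric] f_def[symmetric]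
    by (metis d_def e_def f_def)
qed

text \<open>If \<open>h\<close> commutes modulo \<open>u\<close> with \<open>A\<close> and with
  \<open>y\<close>, the elements commuting with it modulo \<open>u\<close> form a subgroup strictly
  above \<open>A\<close>, hence everything. This is applied to \<open>y\<close>, to the elements of
  \<open>A\<close>, and finally to an arbitrary \<open>h\<close>.\<close>

lemma commute_mod_all:
  assumes fin: "finite (carrier G)" and u: "central_involution u"
    and A: "subgroup A G" "card A * 2 = order G" and y: "y \<in> carrier G" "y \<notin> A"
    and AA: "\<And>a b. \<lbrakk>a \<in> A; b \<in> A\<rbrakk> \<Longrightarrow> a \<otimes> b = b \<otimes> a"
    and Ay: "\<And>a. a \<in> A \<Longrightarrow> commute_mod u a y"
    and gh: "g \<in> carrier G" "h \<in> carrier G"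
  shows "commute_mod u g h"
proof -
  have carA: "a \<in> carrier G" if "a \<in> A" for a using A(1) that subgroup.mem_carrier by metis
  have all: "{k \<in> carrier G. commute_mod u k h} = carrier G"
    if "h \<in> carrier G" "\<And>a. a \<in> A \<Longrightarrow> commute_mod u a h" "commute_mod u y h" for h
    by (rule subgroup_index2_maximal[OF fin A commute_mod_subgroup[OF u that(1)] _ _ y(2)])
      (use that y(1) carA in auto)
  have 1: "commute_mod u k y" if "k \<in> carrier G" for k
    using all[OF y(1) Ay] that unfolding commute_mod_def by blast
  have 2: "commute_mod u k a" if "k \<in> carrier G" "a \<in> A" for k a
    using all[OF carA[OF that(2)]] AA that commute_mod_sym[OF u carA[OF that(2)] y(1) Ay[OF that(2)]]
    unfolding commute_mod_def by blast
  show ?thesis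
    using all[OF gh(2)] gh commute_mod_sym[OF u gh(2)] 1[OF gh(2)] 2[OF gh(2)] carA y(1) by blast
qed

text \<open>If all squares lie in {1, z}, the quotient by {1, z} has exponent dividing 2 and is
  abelian. Otherwise some \<open>x\<close> has its square outside {1, z}. Then \<open>x\<close> and
  \<open>z\<close> generate an abelian subgroup \<open>A\<close> of index 2, and conjugation by an
  element outside \<open>A\<close> multiplies \<open>x\<close> by a central element of order at most
  2.\<close>

lemma exponent4_commute_mod:
  assumes ord: "order G = 16" and exp: "\<And>g. g \<in> carrier G \<Longrightarrow> (g \<otimes> g) \<otimes> (g \<otimes> g) = \<one>"
    and noncomm: "\<exists>g\<in>carrier G. \<exists>h\<in>carrier G. g \<otimes> h \<noteq> h \<otimes> g"
  obtains u where "central_involution u"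
    "\<And>g h. \<lbrakk>g \<in> carrier G; h \<in> carrier G\<rbrakk> \<Longrightarrow> commute_mod u g h"
proof -
  have fin: "finite (carrier G)" using ord order_gt_0_iff_finite by simp
  obtain z where z: "central_involution z" using exists_central_involution[OF ord] by blast
  note cz = central_involutionD[OF z]
  show thesis
  proof (cases "\<forall>g \<in> carrier G. g \<otimes> g = \<one> \<or> g \<otimes> g = z")
    case True
    have sq: "\<exists>e. (e = \<one> \<or> e = z) \<and> g \<otimes> g = e" if "g \<in> carrier G" for g using True that by blast
    have "commute_mod z y x" if xy: "x \<in> carrier G" "y \<in> carrier G" for x y
    proof -
      have ez: "e \<in> carrier G \<and> (\<forall>g \<in> carrier G. e \<otimes> g = g \<otimes> e)" if "e = \<one> \<or> e = z" for e
        using that cz(1) cz(4) by (elim disjE) simp_all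
      obtain a b c where abc: "a = \<one> \<or> a = z" "x \<otimes> x = a" "b = \<one> \<or> b = z" "y \<otimes> y = b"
          "c = \<one> \<or> c = z" "(x \<otimes> y) \<otimes> (x \<otimes> y) = c"
        using sq[OF xy(1)] sq[OF xy(2)] sq[OF m_closed[OF xy]] by blast
      \<comment> \<open>Both (x y)(y x) = x^2 y^2 and (x y)(x y) lie in {1, z}. Cancelling
        \<open>x \<otimes> y\<close> compares \<open>y \<otimes> x\<close> with
        \<open>x \<otimes> y\<close>.\<close>
      have "(x \<otimes> y) \<otimes> (y \<otimes> x) = x \<otimes> (b \<otimes> x)"
        using xy abc(4)[symmetric] by (simp add: m_assoc)
      also have "\<dots> = x \<otimes> (x \<otimes> b)" using ez[OF abc(3)] xy by simp
      also have "\<dots> = a \<otimes> b" using xy ez[OF abc(3)] abc(2) by (simp flip: m_assoc)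
      finally have ab: "(x \<otimes> y) \<otimes> (y \<otimes> x) = a \<otimes> b" .
      have "a \<otimes> b = c \<or> a \<otimes> b = c \<otimes> z" using abc(1,3,5) cz(1,3) by auto
      then have "(x \<otimes> y) \<otimes> (y \<otimes> x) = (x \<otimes> y) \<otimes> (x \<otimes> y) \<or>
        (x \<otimes> y) \<otimes> (y \<otimes> x) = (x \<otimes> y) \<otimes> (x \<otimes> y \<otimes> z)"
        using ab abc(6) xy cz(1) m_assoc[of "x \<otimes> y" "x \<otimes> y" z] by auto
      then have "y \<otimes> x = x \<otimes> y \<or> y \<otimes> x = x \<otimes> y \<otimes> z"
        using xy cz(1) by (metis l_cancel m_closed)
      then show ?thesis unfolding commute_mod_def .
    qed
    then show ?thesis using that z by blast
  next
    case False
    then obtain x where x: "x \<in> carrier G" "x \<otimes> x \<noteq> \<one>" "x \<otimes> x \<noteq> z" by blast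
    define w where "w = x \<otimes> x"
    have w: "w \<in> carrier G" "w \<noteq> \<one>" "w \<noteq> z" "w \<otimes> w = \<one>"
      using x exp unfolding w_def by auto
    define P where "P i = x [^] (i::int)" for i
    have Pc: "P i \<in> carrier G" and Padd: "P i \<otimes> P j = P (i + j)" for i j
      using x(1) unfolding P_def by (auto simp: int_pow_mult)
    have Pinv: "inv (P i) = P (- i)" for i using x(1) unfolding P_def by (simp add: int_pow_neg)
    have P01: "P 0 = \<one>" "P 1 = x" unfolding P_def using x(1) by auto
    have P2: "P 2 = w" using Padd[of 1 1] P01 unfolding w_def by simp
    have P4: "P (4 * i) = \<one>" for i
    proof -
      have "P 4 = \<one>" using Padd[of 2 2] P2 w by simp
      then show ?thesis using x(1) int_pow_pow[of x 4 i] unfolding P_def by simp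
    qed
    \<comment> \<open>The subgroup generated by \<open>x\<close> and the central
      \<open>z\<close>.\<close>
    define A where "A = range P \<union> range (\<lambda>i. P i \<otimes> z)"
    have AE: "\<exists>i. a = P i \<or> a = P i \<otimes> z" if "a \<in> A" for a using that unfolding A_def by blast
    have PA: "P i \<in> A" "P i \<otimes> z \<in> A" for i unfolding A_def by auto
    have zP: "P i \<otimes> z \<otimes> P j = P (i + j) \<otimes> z" "P i \<otimes> (P j \<otimes> z) = P (i + j) \<otimes> z"
      "P i \<otimes> z \<otimes> (P j \<otimes> z) = P (i + j)" for i j
    proof -
      have "P i \<otimes> z \<otimes> P j = P i \<otimes> (P j \<otimes> z)" using Pc cz(1) cz(4)[OF Pc[of j]] by (simp add: m_assoc)
      also show "\<dots> = P (i + j) \<otimes> z" using Pc cz(1) by (simp flip: m_assoc add: Padd)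
      finally show "P i \<otimes> z \<otimes> P j = P (i + j) \<otimes> z" .
      then have "P i \<otimes> z \<otimes> P j \<otimes> z = P (i + j) \<otimes> z \<otimes> z" by simp
      then show "P i \<otimes> z \<otimes> (P j \<otimes> z) = P (i + j)" using Pc cz(1,3) by (simp add: m_assoc)
    qed
    have A: "subgroup A G"
    proof (rule subgroupI)
      show "A \<subseteq> carrier G" "A \<noteq> {}" unfolding A_def using Pc cz(1) by auto
      fix a assume "a \<in> A"
      then obtain i where i: "a = P i \<or> a = P i \<otimes> z" using AE by blast
      have "inv (P i \<otimes> z) = P (- i) \<otimes> z"
        using zP(3)[of "- i" i] P01 Pc cz(1) by (intro inv_equality) auto
      then show "inv a \<in> A" using i Pinv PA by metis
      fix b assume "b \<in> A"
      then obtain j where j: "b = P j \<or> b = P j \<otimes> z" using AE by blast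
      show "a \<otimes> b \<in> A" using i j PA zP Padd by metis
    qed
    have AA: "a \<otimes> b = b \<otimes> a" if ab: "a \<in> A" "b \<in> A" for a b
    proof -
      obtain i j where "a = P i \<or> a = P i \<otimes> z" "b = P j \<or> b = P j \<otimes> z" using AE ab by metis
      then show ?thesis using zP[of i j] zP[of j i] Padd[of i j] Padd[of j i] add.commute[of i j] by metis
    qed
    have carA: "a \<in> carrier G" if "a \<in> A" for a using subgroup.mem_carrier[OF A that] .
    have AG: "A \<noteq> carrier G" using noncomm AA by blast
    then obtain y where y: "y \<in> carrier G" "y \<notin> A" using carA by blast
    have "card A * card (rcosets A) = 16"
      using lagrange_finite[OF fin A] ord by (simp add: mult.commute)
    then have "card A dvd 16" by (metis dvd_triv_left)
    then have "card A dvd 2 ^ 4" by simp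
    then obtain k where k: "k \<le> 4" "card A = 2 ^ k"
      using divides_primepow_nat[OF two_is_prime_nat] by blast
    have "card A < 16"
      using AG carA psubset_card_mono[OF fin, of A] ord unfolding order_def by auto
    \<comment> \<open>\<open>card A\<close> is a power of 2 below 16, so five distinct elements
      force it to be 8.\<close>
    moreover have "card A \<ge> 5"
    proof -
      have fA: "finite A" using finite_subset[OF subgroup.subset[OF A] fin] .
      have "{\<one>, x, w, z, x \<otimes> z} \<subseteq> A" using PA[of 0] PA[of 1] PA[of 2] P01 P2 cz(1) by auto
      moreover have "x \<noteq> \<one>" "x \<noteq> w" "x \<noteq> z" "x \<otimes> z \<noteq> \<one>" "x \<otimes> z \<noteq> x" "x \<otimes> z \<noteq> w" "x \<otimes> z \<noteq> z"
      proof -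
        show x1: "x \<noteq> \<one>" using x by auto
        show "x \<noteq> w" using x(1) x1 unfolding w_def using l_cancel_one' by blast
        show xz: "x \<noteq> z" using x cz(3) by auto
        have *: "x \<otimes> z = b \<longleftrightarrow> x = b \<otimes> z" if "b \<in> carrier G" for b
          using that x(1) cz(1,3) by (metis m_assoc r_one)
        show "x \<otimes> z \<noteq> \<one>" using *[of \<one>] xz cz(1) by auto
        show "x \<otimes> z \<noteq> x" using x(1) cz(1,2) by simp
        show "x \<otimes> z \<noteq> w" using x(1) xz cz(1) unfolding w_def by auto
        show "x \<otimes> z \<noteq> z" using x(1) x1 cz(1) by simp
      qed
      then have "card {\<one>, x, w, z, x \<otimes> z} = 5" using w(2,3) cz(2) by auto
      ultimately show ?thesis using card_mono[OF fA] by metis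
    qed
    moreover have "k = 0 \<or> k = 1 \<or> k = 2 \<or> k = 3 \<or> k = 4" using k(1) by linarith
    ultimately have A8: "card A * 2 = order G" using k(2) ord by auto
    have iy: "inv y \<notin> A" using y A subgroup.m_inv_closed by (metis inv_inv)
    have "y \<otimes> x \<notin> A"
    proof
      assume "y \<otimes> x \<in> A"
      then have "y \<otimes> x \<otimes> P (-1) \<in> A" using subgroup.m_closed[OF A _ PA(1)] by blast
      moreover have "y \<otimes> x \<otimes> P (-1) = y"
        using y x(1) Pc[of "-1"] Padd[of 1 "-1"] P01 by (simp add: m_assoc)
      ultimately show False using y by simp
    qed
    \<comment> \<open>Both \<open>y \<otimes> x\<close> and \<open>inv y\<close> lie outside the
      subgroup \<open>A\<close> of index 2.\<close>
    then have "y \<otimes> x \<otimes> inv y \<in> A"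
      using subgroup_index2_mult[OF fin A A8] iy x(1) y(1) by blast
    define c where "c = y \<otimes> x \<otimes> inv y"
    have cc: "c \<in> carrier G" and cy: "c \<otimes> y = y \<otimes> x" using y x(1) unfolding c_def by (auto simp: m_assoc)
    obtain i where i: "c = P i \<or> c = P i \<otimes> z"
      using AE \<open>y \<otimes> x \<otimes> inv y \<in> A\<close> unfolding c_def by blast
    have csq: "c \<otimes> c = P (i + i)" using i Padd zP by metis
    have ccy: "c \<otimes> c \<otimes> y = y \<otimes> w"
    proof -
      have "c \<otimes> c \<otimes> y = c \<otimes> (y \<otimes> x)" using cc cy x(1) y(1) by (simp add: m_assoc)
      also have "\<dots> = (c \<otimes> y) \<otimes> x" using cc x(1) y(1) by (simp add: m_assoc)
      finally have "c \<otimes> c \<otimes> y = (c \<otimes> y) \<otimes> x" .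
      then show ?thesis using cy x(1) y(1) unfolding w_def by (simp add: m_assoc)
    qed
    \<comment> \<open>An even \<open>i\<close> would make c^2 a power of x^4, hence one, although
      c^2 is a conjugate of \<open>w\<close>.\<close>
    have "odd i"
    proof
      assume "even i"
      then obtain j where "i + i = 4 * j" by (auto elim!: evenE)
      then have "c \<otimes> c = \<one>" using csq P4 by simp
      then show False using ccy y(1) w(1,2) by simp
    qed
    then obtain j where j: "i = 1 + 2 * j" by (metis oddE add.commute)
    define d where "d = P (2 * j)"
    have d: "d = \<one> \<or> d = w"
    proof (cases "even j")
      case True
      then show ?thesis unfolding d_def using P4 by (auto elim!: evenE)
    next
      case False
      then obtain l where "j = 2 * l + 1" by (auto elim!: oddE)
      then have "d = P (4 * l) \<otimes> P 2" unfolding d_def Padd by simp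
      then show ?thesis using P4[of l] P2 w(1) by simp
    qed
    have Pi: "P i = x \<otimes> d" unfolding d_def using Padd[of 1 "2 * j"] P01 j by simp
    \<comment> \<open>For odd \<open>i\<close> the exponent 2 i is 2 modulo 4, so the conjugate of
      \<open>w\<close> by \<open>y\<close> is \<open>w\<close> itself. This makes \<open>w\<close>
      central.\<close>
    have "c \<otimes> c = w"
    proof -
      have "i + i = 2 + 4 * j" using j by simp
      then show ?thesis using csq Padd[of 2 "4 * j"] P4[of j] P2 w(1) by simp
    qed
    then have wy: "y \<in> centralizer w" using ccy y(1) unfolding centralizer_def by simp
    have "A \<subseteq> centralizer w" using AA PA(1)[of 2] P2 carA unfolding centralizer_def by auto
    then have "centralizer w = carrier G"
      using subgroup_index2_maximal[OF fin A A8 centralizer_subgroup[OF w(1)] _ wy y(2)] by blast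
    then have wcent: "w \<otimes> g = g \<otimes> w" if "g \<in> carrier G" for g
    proof -
      have "g \<in> centralizer w" using that \<open>centralizer w = carrier G\<close> by blast
      then show ?thesis unfolding centralizer_def by simp
    qed
    have ciw: "central_involution w" using w wcent unfolding central_involution_def by blast
    define v where "v = w \<otimes> z"
    have civ: "central_involution v"
    proof -
      have vc: "v \<in> carrier G" using w cz(1) unfolding v_def by simp
      moreover have "v \<noteq> \<one>"
      proof
        assume "v = \<one>"
        then have "w \<otimes> z \<otimes> z = z" using cz(1) unfolding v_def by simp
        then show False using w cz(1,3) by (simp add: m_assoc)
      qed
      moreover have "v \<otimes> v = \<one>"
        using w(1,4) cz(1,3) cz(5)[OF w(1) cz(1)] unfolding v_def by (simp add: m_assoc)
      moreover have "v \<otimes> g = g \<otimes> v" if "g \<in> carrier G" for g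
      proof -
        have "v \<otimes> g = w \<otimes> (g \<otimes> z)" using that w(1) cz(1) cz(4)[OF that] unfolding v_def by (simp add: m_assoc)
        also have "\<dots> = g \<otimes> w \<otimes> z" using that w(1) cz(1) wcent[OF that] by (simp flip: m_assoc)
        finally show ?thesis unfolding v_def using that w(1) cz(1) by (simp add: m_assoc)
      qed
      ultimately show ?thesis unfolding central_involution_def by blast
    qed
    \<comment> \<open>The four possible values of \<open>c\<close> are \<open>x\<close> times 1,
      \<open>w\<close>, \<open>z\<close> or \<open>v\<close>, and the last three factors are central
      involutions. For the factor 1 any central involution serves as \<open>u\<close>.\<close>
    have "\<exists>u e. central_involution u \<and> (e = \<one> \<or> e = u) \<and> c = x \<otimes> e"
    proof -
      have "c = x \<otimes> \<one> \<or> c = x \<otimes> w \<or> c = x \<otimes> z \<or> c = x \<otimes> v"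
        using i d Pi x(1) w(1) cz(1) unfolding v_def by (auto simp: m_assoc)
      then show ?thesis using z ciw civ by blast
    qed
    then obtain u e where u: "central_involution u" and e: "e = \<one> \<or> e = u" "c = x \<otimes> e" by blast
    note cu = central_involutionD[OF u]
    have "commute_mod u y x"
      using cy e x(1) y(1) cu(1) cu(4)[OF y(1)] unfolding commute_mod_def
      by (auto simp: m_assoc)
    then have xy: "commute_mod u x y" using commute_mod_sym[OF u y(1) x(1)] by blast
    \<comment> \<open>Commuting with \<open>y\<close> modulo \<open>u\<close> defines a subgroup, so
      only the generators \<open>x\<close> and \<open>z\<close> of \<open>A\<close> need
      checking.\<close>
    have Ay: "commute_mod u a y" if "a \<in> A" for a
    proof -
      let ?C = "{g \<in> carrier G. commute_mod u g y}"
      have C: "subgroup ?C G" using commute_mod_subgroup[OF u y(1)] .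
      have "x \<in> ?C" using xy x(1) by blast
      then have P: "P i \<in> ?C" for i unfolding P_def by (rule subgroup_int_pow_closed[OF C])
      have "commute_mod u z y" using cz(4)[OF y(1)] unfolding commute_mod_def by blast
      then have "z \<in> ?C" using cz(1) by blast
      then have "P i \<otimes> z \<in> ?C" for i using subgroup.m_closed[OF C P] by blast
      then have "a \<in> ?C" using AE[OF that] P by blast
      then show ?thesis by blast
    qed
    show ?thesis using that[OF u] commute_mod_all[OF fin u A A8 y AA Ay] by blast
  qed
qed

lemma t_group_exponent:
  assumes t_group: "t_group G" and ord: "order G = 16"
    and noncomm: "\<exists>g\<in>carrier G. \<exists>h\<in>carrier G. g \<otimes> h \<noteq> h \<otimes> g"
  shows "\<exists>g \<in> carrier G. (g \<otimes> g) \<otimes> (g \<otimes> g) \<noteq> \<one>"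
proof (rule ccontr)
  assume "\<not> ?thesis"
  then have exp: "(g \<otimes> g) \<otimes> (g \<otimes> g) = \<one>" if "g \<in> carrier G" for g using that by blast
  have fin: "finite (carrier G)" using ord order_gt_0_iff_finite by simp
  obtain u where u: "central_involution u"
    and comm: "\<And>g h. \<lbrakk>g \<in> carrier G; h \<in> carrier G\<rbrakk> \<Longrightarrow> commute_mod u g h"
    using exponent4_commute_mod[OF ord exp noncomm] by blast
  note cu = central_involutionD[OF u]
  obtain x y where x: "x \<in> carrier G" and y: "y \<in> carrier G" and xy: "x \<otimes> y \<noteq> y \<otimes> x"
    using noncomm by blast
  \<comment> \<open>The quotient by {1, v} is abelian too, so the factor by which
    \<open>x \<otimes> y\<close> and \<open>y \<otimes> x\<close> differ is both \<open>u\<close>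
    and \<open>v\<close>.\<close>
  have uniq: "v = u" if v: "central_involution v" for v
  proof -
    have "x \<otimes> y = y \<otimes> x \<otimes> v" "x \<otimes> y = y \<otimes> x \<otimes> u"
      using t_group_commute_mod[OF t_group u v comm x y] comm[OF x y] xy
      unfolding commute_mod_def by auto
    then show ?thesis using x y cu(1) central_involutionD(1)[OF v] by (metis l_cancel m_closed)
  qed
  \<comment> \<open>Moving \<open>g\<close> past \<open>h\<close> costs at most a factor
    \<open>u\<close>, and two such factors cancel, so g^2 is central. By exponent 4 it would
    otherwise be a second central involution.\<close>
  have sq: "g \<otimes> g = \<one> \<or> g \<otimes> g = u" if g: "g \<in> carrier G" for g
  proof (rule ccontr)
    assume neg: "\<not> ?thesis"
    have "(g \<otimes> g) \<otimes> h = h \<otimes> (g \<otimes> g)" if h: "h \<in> carrier G" for h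
    proof -
      have "g \<otimes> h = h \<otimes> g \<or> g \<otimes> h = h \<otimes> g \<otimes> u" using comm[OF g h] unfolding commute_mod_def .
      then show ?thesis
      proof
        assume e: "g \<otimes> h = h \<otimes> g"
        show ?thesis using e mult_eq_extend[OF e g h] g h by (simp add: m_assoc)
      next
        assume e: "g \<otimes> h = h \<otimes> g \<otimes> u"
        have "(g \<otimes> g) \<otimes> h = g \<otimes> (h \<otimes> g \<otimes> u)" using e g h by (simp add: m_assoc)
        also have "\<dots> = (h \<otimes> g \<otimes> u) \<otimes> g \<otimes> u" using e g h cu(1) by (simp flip: m_assoc)
        also have "\<dots> = h \<otimes> (g \<otimes> g)" using g h cu(1,3) cu(5)[OF g cu(1)] by (simp add: m_assoc)
        finally show ?thesis .
      qed
    qed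
    then have "central_involution (g \<otimes> g)"
      using neg g exp[OF g] unfolding central_involution_def by blast
    then show False using uniq neg by blast
  qed
  \<comment> \<open>The common centralizer of \<open>x\<close> and \<open>y\<close>. It is shown to
    have order 4 and to consist of the powers of a central element \<open>w\<close>.\<close>
  define C where "C = {g \<in> carrier G. g \<otimes> x = x \<otimes> g \<and> g \<otimes> y = y \<otimes> g}"
  have C_eq: "C = centralizer x \<inter> centralizer y" unfolding C_def centralizer_def by blast
  have C: "subgroup C G"
    unfolding C_eq using subgroups_Inter_pair centralizer_subgroup x y by blast
  have CI: "g \<in> C" if "g \<in> carrier G" "g \<otimes> x = x \<otimes> g" "g \<otimes> y = y \<otimes> g" for g
    using that unfolding C_def by blast
  have Cc: "g \<in> carrier G" if "g \<in> C" for g using that unfolding C_def by blast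
  have yx: "x \<otimes> y = y \<otimes> x \<otimes> u" "y \<otimes> x = x \<otimes> y \<otimes> u"
    using comm[OF x y] comm[OF y x] xy unfolding commute_mod_def by auto
  \<comment> \<open>Multiplying by \<open>x\<close> toggles whether an element commutes with
    \<open>y\<close>, and multiplying by \<open>y\<close> toggles whether it commutes with
    \<open>x\<close>. Hence four translates of \<open>C\<close> cover \<open>G\<close>, and
    \<open>C\<close> has at least 4 elements.\<close>
  have cover: "g \<in> C \<or> g \<otimes> x \<in> C \<or> g \<otimes> y \<in> C \<or> g \<otimes> x \<otimes> y \<in> C" if g: "g \<in> carrier G" for g
  proof -
    have gx: "g \<otimes> x = x \<otimes> g \<or> g \<otimes> x = x \<otimes> (g \<otimes> u)" and gy: "g \<otimes> y = y \<otimes> g \<or> g \<otimes> y = y \<otimes> (g \<otimes> u)"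
      using comm[OF g x] comm[OF g y] g x y cu(1) unfolding commute_mod_def by (simp_all add: m_assoc)
    consider "g \<otimes> x = x \<otimes> g" "g \<otimes> y = y \<otimes> g" | "g \<otimes> x = x \<otimes> g" "g \<otimes> y = y \<otimes> (g \<otimes> u)"
      | "g \<otimes> x = x \<otimes> (g \<otimes> u)" "g \<otimes> y = y \<otimes> g" | "g \<otimes> x = x \<otimes> (g \<otimes> u)" "g \<otimes> y = y \<otimes> (g \<otimes> u)"
      using gx gy by blast
    then show ?thesis
    proof cases
      case 1
      then show ?thesis using CI g by blast
    next
      case 2
      have "g \<otimes> x \<in> C"
        using g x y cu(1) 2 mult_eq_extend[OF 2(1) g x] mult_eq_extend[OF 2(2) g y] yx(1) mult_eq_extend[OF yx(1) x y]
        by (intro CI) (simp_all add: m_assoc cu(3,6) cu(5)[OF x] cu(5)[OF y] cu(5)[OF g] cu(4)[OF x] cu(4)[OF y] cu(4)[OF g])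
      then show ?thesis by blast
    next
      case 3
      have "g \<otimes> y \<in> C"
        using g x y cu(1) 3 mult_eq_extend[OF 3(1) g x] mult_eq_extend[OF 3(2) g y] yx(2) mult_eq_extend[OF yx(2) y x]
        by (intro CI) (simp_all add: m_assoc cu(3,6) cu(5)[OF x] cu(5)[OF y] cu(5)[OF g] cu(4)[OF x] cu(4)[OF y] cu(4)[OF g])
      then show ?thesis by blast
    next
      case 4
      have "g \<otimes> x \<otimes> y \<in> C"
        using g x y cu(1) 4 mult_eq_extend[OF 4(1) g x] mult_eq_extend[OF 4(2) g y] yx(2) mult_eq_extend[OF yx(2) y x]
        by (intro CI) (simp_all add: m_assoc cu(3,6) cu(5)[OF x] cu(5)[OF y] cu(5)[OF g] cu(4)[OF x] cu(4)[OF y] cu(4)[OF g])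
      then show ?thesis by blast
    qed
  qed
  have fC: "finite C" using finite_subset[OF subgroup.subset[OF C] fin] .
  have "card C \<ge> 4"
  proof -
    have inj: "card {g \<in> carrier G. g \<otimes> k \<in> C} \<le> card C" if k: "k \<in> carrier G" for k
      using k by (intro card_inj_on_le[of "\<lambda>g. g \<otimes> k"] fC) (auto simp: inj_on_def)
    have "carrier G \<subseteq> {g \<in> carrier G. g \<otimes> \<one> \<in> C} \<union> {g \<in> carrier G. g \<otimes> x \<in> C} \<union>
      {g \<in> carrier G. g \<otimes> y \<in> C} \<union> {g \<in> carrier G. g \<otimes> (x \<otimes> y) \<in> C}" (is "_ \<subseteq> ?A \<union> ?B \<union> ?D \<union> ?E")
    proof
      fix g assume g: "g \<in> carrier G"
      then show "g \<in> ?A \<union> ?B \<union> ?D \<union> ?E" using cover[OF g] x y by (simp add: m_assoc)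
    qed
    moreover have "finite (?A \<union> ?B \<union> ?D \<union> ?E)" using fin by simp
    ultimately have "16 \<le> card (?A \<union> ?B \<union> ?D \<union> ?E)"
      using card_mono[of "?A \<union> ?B \<union> ?D \<union> ?E" "carrier G"] ord unfolding order_def by linarith
    also have "\<dots> \<le> card ?A + card ?B + card ?D + card ?E"
      by (meson add_mono_thms_linordered_semiring(3) card_Un_le le_trans)
    also have "\<dots> \<le> card C + card C + card C + card C"
      using inj[OF one_closed] inj[OF x] inj[OF y] inj[OF m_closed[OF x y]] by linarith
    finally show ?thesis by simp
  qed
  \<comment> \<open>In the chain from \<open>C\<close> through \<open>centralizer x\<close> to
    \<open>G\<close> both inclusions are strict, the first because of \<open>x\<close> and the
    second because of \<open>y\<close>. Each index is therefore at least 2.\<close>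
  moreover have "card C \<le> 4"
  proof -
    interpret X: group "G\<lparr>carrier := centralizer x\<rparr>"
      using subgroup_imp_group[OF centralizer_subgroup[OF x]] .
    have sub: "subgroup C (G\<lparr>carrier := centralizer x\<rparr>)"
      using C C_eq centralizer_subgroup[OF x] subgroup_incl by blast
    have fX: "finite (centralizer x)"
      using finite_subset[OF subgroup.subset[OF centralizer_subgroup[OF x]] fin] .
    obtain k where k: "card C * k = card (centralizer x)"
      using X.lagrange_finite[OF _ sub] fX by (metis order_def mult.commute partial_object.simps(1) partial_object.update_convs(1) partial_object.surjective)
    obtain l where l: "card (centralizer x) * l = 16"
      using lagrange_finite[OF fin centralizer_subgroup[OF x]] ord by (metis mult.commute)
    have "C \<subset> centralizer x"
      using C_eq x xy by (auto simp: centralizer_def)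
    then have "card C < card (centralizer x)" using fX psubset_card_mono by blast
    then have "k \<noteq> 0" using k by (metis mult_0_right not_less_zero)
    moreover have "k \<noteq> 1" using k \<open>card C < _\<close> by auto
    ultimately have k2: "k \<ge> 2" by simp
    have "y \<notin> centralizer x" using xy by (simp add: centralizer_def)
    then have "centralizer x \<subset> carrier G" using y by (auto simp: centralizer_def)
    then have "card (centralizer x) < 16" using fin psubset_card_mono ord unfolding order_def by metis
    then have "l \<noteq> 1" using l by auto
    moreover have "l \<noteq> 0" using l by (metis mult_0_right zero_neq_numeral)
    ultimately have l2: "l \<ge> 2" by simp
    have "card C * 4 \<le> card C * (k * l)" using mult_le_mono[OF k2 l2] by simp
    also have "\<dots> = 16" using k l by (simp add: mult.assoc[symmetric])
    finally show ?thesis by simp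
  qed
  ultimately have C4: "card C = 4" by simp
  have 1: "\<one> \<in> C" "u \<in> C" using CI x y cu(1) cu(4)[OF x] cu(4)[OF y] by auto
  have "card {\<one>, u} < card C" using C4 cu(2) by auto
  then have "\<not> C \<subseteq> {\<one>, u}" using card_mono[of "{\<one>, u}" C] by auto
  then obtain w where w: "w \<in> C" "w \<noteq> \<one>" "w \<noteq> u" by blast
  have wc: "w \<in> carrier G" using w Cc by blast
  have wx: "w \<otimes> x = x \<otimes> w" and wy: "w \<otimes> y = y \<otimes> w" using w(1) unfolding C_def by auto
  have "{\<one>, u, w, w \<otimes> u} = C"
  proof (rule card_subset_eq[OF fC])
    show "{\<one>, u, w, w \<otimes> u} \<subseteq> C" using 1 w subgroup.m_closed[OF C] by blast
    have "w \<otimes> u \<noteq> \<one>"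
    proof
      assume "w \<otimes> u = \<one>"
      then have "w \<otimes> u \<otimes> u = u" using cu(1) by simp
      then show False using w wc cu(1,3) by (simp add: m_assoc)
    qed
    moreover have "w \<otimes> u \<noteq> u" "w \<otimes> u \<noteq> w" using w wc cu(1,2) by auto
    ultimately show "card {\<one>, u, w, w \<otimes> u} = card C" using C4 w cu(2) by auto
  qed
  \<comment> \<open>All four elements of \<open>C\<close> commute with \<open>w\<close>, and so do
    \<open>x\<close> and \<open>y\<close>. The translates covering \<open>G\<close> then show that
    \<open>w\<close> is central.\<close>
  then have Cw: "C \<subseteq> centralizer w"
    using wc cu(1) cu(4)[OF wc] unfolding centralizer_def by (auto simp: m_assoc)
  have w_central: "g \<in> centralizer w" if g: "g \<in> carrier G" for g
  proof -
    note Z = centralizer_subgroup[OF wc]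
    have xyw: "x \<in> centralizer w" "y \<in> centralizer w" using wx wy x y unfolding centralizer_def by auto
    have cancel: "h \<in> centralizer w" if "h \<otimes> k \<in> centralizer w" "k \<in> centralizer w" "h \<in> carrier G" for h k
    proof -
      have "k \<in> carrier G" using that(2) unfolding centralizer_def by blast
      then have "h \<otimes> k \<otimes> inv k = h" using that(3) by (simp add: m_assoc)
      then show ?thesis using subgroup.m_closed[OF Z that(1) subgroup.m_inv_closed[OF Z that(2)]] by simp
    qed
    show ?thesis using cover[OF g] Cw cancel xyw g x y by (meson m_closed subsetD)
  qed
  have wcomm: "w \<otimes> g = g \<otimes> w" if "g \<in> carrier G" for g
    using w_central[OF that] unfolding centralizer_def by simp
  have ww: "w \<otimes> w = u"
  proof (rule ccontr)
    assume "w \<otimes> w \<noteq> u"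
    then have "central_involution w"
      using sq[OF wc] w(2) wc wcomm unfolding central_involution_def by blast
    then show False using uniq w by blast
  qed
  \<comment> \<open>If x^2 is not one then x^2 = u, and (x w)^2 = u u = 1, while
    \<open>x \<otimes> w\<close> still fails to commute with \<open>y\<close>.\<close>
  have "\<exists>t \<in> carrier G. t \<otimes> t = \<one> \<and> t \<otimes> y \<noteq> y \<otimes> t"
  proof (cases "x \<otimes> x = \<one>")
    case True
    then show ?thesis using x xy by blast
  next
    case False
    then have xx: "x \<otimes> x = u" using sq[OF x] by blast
    have "(x \<otimes> w) \<otimes> (x \<otimes> w) = \<one>"
      using x wc wx mult_eq_extend[OF wx wc x] ww xx mult_eq_extend[OF xx x x] cu(1,3) by (simp add: m_assoc)
    moreover have "(x \<otimes> w) \<otimes> y \<noteq> y \<otimes> (x \<otimes> w)"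
    proof
      assume "(x \<otimes> w) \<otimes> y = y \<otimes> (x \<otimes> w)"
      then have "x \<otimes> y \<otimes> w = y \<otimes> x \<otimes> w" using x y wc wy by (simp add: m_assoc)
      then show False using x y wc xy by simp
    qed
    ultimately show ?thesis using x wc by blast
  qed
  then obtain t where t: "t \<in> carrier G" "t \<otimes> t = \<one>" "t \<otimes> y \<noteq> y \<otimes> t" by blast
  have "t \<noteq> \<one>" "\<not> central_involution t" using t y unfolding central_involution_def by auto
  then obtain p where p: "p \<in> hom G G" "card (p ` carrier G) * 2 = order G"
    "\<And>g. g \<in> carrier G \<Longrightarrow> p g = \<one> \<longleftrightarrow> g = \<one> \<or> g = u"
    using t_group_noncentral_involution[OF t_group u t(1) _ t(2)] by metis
  interpret p: group_hom G G p by unfold_locales (rule p(1))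
  let ?K = "p ` carrier G"
  have K: "subgroup ?K G" by (rule p.img_is_subgroup)
  \<comment> \<open>Squares of \<open>G\<close> lie in the kernel {1, u} of \<open>p\<close>, so the
    complement \<open>?K\<close> has exponent 2 and is abelian.\<close>
  have K2: "k \<otimes> k = \<one>" if k: "k \<in> ?K" for k
  proof -
    obtain g where g: "g \<in> carrier G" "k = p g" using k by blast
    then have "k \<otimes> k = p (g \<otimes> g)" by simp
    then show ?thesis using p(3)[of "g \<otimes> g"] sq[OF g(1)] g(1) by auto
  qed
  have Kc: "k \<in> carrier G" if "k \<in> ?K" for k using subgroup.mem_carrier[OF K that] .
  have Kinv: "inv k = k" if "k \<in> ?K" for k using inv_equality[OF K2[OF that]] Kc[OF that] by blast
  have Kcomm: "a \<otimes> b = b \<otimes> a" if ab: "a \<in> ?K" "b \<in> ?K" for a b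
  proof -
    have "a \<otimes> b = inv (a \<otimes> b)" using Kinv[OF subgroup.m_closed[OF K ab]] by simp
    then show ?thesis using Kinv ab Kc inv_mult_group by simp
  qed
  \<comment> \<open>Since \<open>?K\<close> has index 2, \<open>?K\<close> and the central element
    \<open>w\<close> generate \<open>G\<close>. This makes first \<open>?K\<close> central and then
    \<open>G\<close> abelian.\<close>
  have wK: "w \<notin> ?K" using K2 ww cu(2) by blast
  have cent_k: "centralizer k = carrier G" if k: "k \<in> ?K" for k
    by (rule subgroup_index2_maximal[OF fin K p(2) centralizer_subgroup[OF Kc[OF k]] _ _ wK])
      (use Kcomm k Kc wc wcomm in \<open>auto simp: centralizer_def\<close>)
  have "?K \<subseteq> centralizer g" if g: "g \<in> carrier G" for g
  proof
    fix k assume k: "k \<in> ?K"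
    have "g \<in> centralizer k" using cent_k[OF k] g by simp
    then show "k \<in> centralizer g" using Kc[OF k] by (simp add: centralizer_def)
  qed
  then have "centralizer g = carrier G" if g: "g \<in> carrier G" for g
    using subgroup_index2_maximal[OF fin K p(2) centralizer_subgroup[OF g] _ _ wK] g wc wcomm[OF g]
    unfolding centralizer_def by blast
  then show False using x y xy unfolding centralizer_def by blast
qed

end

section \<open>Cyclic subgroups of index 2\<close>

text \<open>\<open>E i j\<close> stands for \<open>a\<^sup>i b\<^sup>j\<close>, where \<open>a\<close> has order 8, \<open>b a b\<^sup>-\<^sup>1 = a\<^sup>r\<close> and \<open>b\<^sup>2 = a\<^sup>s\<close>.\<close>

locale cyclic8_extension = group G for G (structure) +
  fixes E :: "int \<Rightarrow> bool \<Rightarrow> 'a" and r s :: int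
  assumes E_closed [simp]: "E i j \<in> carrier G"
    and E_mult: "E i j \<otimes> E k l = E (i + (if j then r * k else k) + (if j \<and> l then s else 0)) (j \<noteq> l)"
    and E_eq: "E i j = E k l \<longleftrightarrow> j = l \<and> 8 dvd i - k"
    and E_surj: "g \<in> carrier G \<Longrightarrow> \<exists>i j. g = E i j"

lemma (in group) conj_int_pow:
  assumes "b \<in> carrier G" "c \<in> carrier G" and conj: "b \<otimes> c = c [^] (r::int) \<otimes> b"
  shows "b \<otimes> c [^] (k::int) = c [^] (r * k) \<otimes> b"
proof (induction k rule: int_induct[where k = 0])
  case base
  show ?case using assms by simp
next
  case (step1 i)
  have "b \<otimes> c [^] (i + 1) = (b \<otimes> c [^] i) \<otimes> c"
    using assms by (simp add: int_pow_mult m_assoc)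
  also have "\<dots> = c [^] (r * i) \<otimes> (c [^] r \<otimes> b)"
    using assms(1,2) by (simp add: step1 m_assoc conj)
  also have "\<dots> = c [^] (r * i + r) \<otimes> b"
    using assms(1,2) by (simp add: int_pow_mult m_assoc)
  finally show ?case by (simp add: algebra_simps)
next
  case (step2 i)
  have "b \<otimes> c [^] (i - 1) \<otimes> c = b \<otimes> (c [^] (i - 1) \<otimes> c [^] (1::int))"
    using assms by (simp add: m_assoc)
  also have "\<dots> = b \<otimes> c [^] i" using assms(2) int_pow_mult[of c "i - 1" 1] by simp
  also have "\<dots> = c [^] (r * (i - 1) + r) \<otimes> b"
    unfolding step2 by (simp add: algebra_simps)
  also have "\<dots> = c [^] (r * (i - 1)) \<otimes> (c [^] r \<otimes> b)"
    using assms(1,2) by (simp add: int_pow_mult m_assoc)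
  also have "\<dots> = c [^] (r * (i - 1)) \<otimes> b \<otimes> c"
    using assms(1,2) by (simp add: m_assoc conj)
  finally show ?case using assms(1,2) by simp
qed

text \<open>The order of \<open>a\<close> is a power of 2 not dividing 4, so \<open>a\<close> or its
  square has order 8. The cyclic subgroup so obtained has index 2, hence any b outside it normalizes
  it and has its square inside. This yields \<open>r\<close> and \<open>s\<close>.\<close>

lemma (in group) exists_cyclic8_extension:
  assumes ord: "order G = 16" and a: "a \<in> carrier G" "(a \<otimes> a) \<otimes> (a \<otimes> a) \<noteq> \<one>"
  obtains E r s where "cyclic8_extension G E r s" "r \<in> {0..7}" "s \<in> {0..7}"
proof -
  have fin: "finite (carrier G)" using ord order_gt_0_iff_finite by simp
  have "\<exists>c \<in> carrier G. ord c = 8"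
  proof -
    have "ord a dvd 2 ^ 4" using ord_dvd_group_order[OF a(1)] ord by simp
    then obtain k where k: "k \<le> 4" "ord a = 2 ^ k"
      using divides_primepow_nat[OF two_is_prime_nat] by blast
    have "a [^] (4::nat) \<noteq> \<one>" using a by (simp add: numeral_eq_Suc m_assoc)
    then have n4: "\<not> ord a dvd 4" using pow_eq_id[OF a(1)] by blast
    have "k = 0 \<or> k = 1 \<or> k = 2 \<or> k = 3 \<or> k = 4" using k(1) by linarith
    then have "ord a = 8 \<or> ord a = 16" using k(2) n4 by auto
    then show ?thesis
    proof
      assume o: "ord a = 16"
      have "ord (a [^] (2::nat)) = 8"
        using ord_pow[of a 2] a(1) o by simp
      then show ?thesis using a(1) by blast
    qed (use a in blast)
  qed
  then obtain c where c: "c \<in> carrier G" "ord c = 8" by blast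
  have pow_eq: "c [^] i = c [^] j \<longleftrightarrow> 8 dvd i - j" for i j :: int
    using int_pow_eq[OF c(1), of i j] c(2) by (simp add: dvd_diff_commute)
  define A where "A = range (\<lambda>i::int. c [^] i)"
  have Apow: "c [^] i \<in> A" for i :: int unfolding A_def by blast
  have A: "subgroup A G"
  proof (rule subgroupI)
    fix x y assume "x \<in> A" "y \<in> A"
    then obtain i j :: int where ij: "x = c [^] i" "y = c [^] j" unfolding A_def by blast
    show "inv x \<in> A" using Apow[of "- i"] c(1) ij by (simp add: int_pow_neg)
    show "x \<otimes> y \<in> A" using Apow[of "i + j"] c(1) ij by (simp add: int_pow_mult)
  qed (use c in \<open>auto simp: A_def\<close>)
  have A_eq: "A = (\<lambda>i. c [^] i) ` {0..7::int}"
  proof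
    show "A \<subseteq> (\<lambda>i. c [^] i) ` {0..7::int}"
    proof
      fix x assume "x \<in> A"
      then obtain i :: int where "x = c [^] i" unfolding A_def by blast
      then have "x = c [^] (i mod 8)" using pow_eq dvd_minus_mod by simp
      moreover have "i mod 8 \<in> {0..7}" by simp
      ultimately show "x \<in> (\<lambda>i. c [^] i) ` {0..7::int}" by blast
    qed
  qed (auto simp: A_def)
  have "inj_on (\<lambda>i. c [^] i) {0..7::int}" by (auto simp: inj_on_def pow_eq) presburger
  then have "card A = 8" unfolding A_eq by (simp add: card_image)
  then have A8: "card A * 2 = order G" using ord by simp
  have "A \<noteq> carrier G" using \<open>card A = 8\<close> ord by (auto simp: order_def)
  then obtain b where b: "b \<in> carrier G" "b \<notin> A" using subgroup.subset[OF A] by blast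
  have reduce: "\<exists>i \<in> {0..7::int}. x = c [^] i" if "x \<in> A" for x
    using that A_eq by blast
  have ib: "inv b \<notin> A" using b subgroup.m_inv_closed[OF A] inv_inv by metis
  have bc: "b \<otimes> c \<notin> A"
  proof
    assume "b \<otimes> c \<in> A"
    then have "b \<otimes> c \<otimes> inv c \<in> A"
      using subgroup.m_closed[OF A] subgroup.m_inv_closed[OF A] Apow[of 1] c(1) by simp
    then show False using b c(1) by (simp add: m_assoc)
  qed
  have "b \<otimes> c \<otimes> inv b \<in> A"
    using subgroup_index2_mult[OF fin A A8 _ bc _ ib] b c(1) by simp
  then obtain r :: int where r: "r \<in> {0..7}" "b \<otimes> c \<otimes> inv b = c [^] r" using reduce by blast
  then have "b \<otimes> c \<otimes> inv b \<otimes> b = c [^] r \<otimes> b" by simp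
  then have conj: "b \<otimes> c = c [^] r \<otimes> b" using b c(1) by (simp add: m_assoc)
  obtain s :: int where s: "s \<in> {0..7}" "b \<otimes> b = c [^] s"
    using reduce[OF subgroup_index2_mult[OF fin A A8 b b]] by blast
  note bpow = conj_int_pow[OF b(1) c(1) conj]
  define E where "E i j = (if j then c [^] i \<otimes> b else c [^] i)" for i :: int and j
  have "cyclic8_extension G E r s"
  proof (unfold_locales)
    show Ec: "E i j \<in> carrier G" for i j unfolding E_def using b c by simp
    show "E i j \<otimes> E k l = E (i + (if j then r * k else k) + (if j \<and> l then s else 0)) (j \<noteq> l)" for i j k l
    proof -
      have 1: "c [^] i \<otimes> b \<otimes> c [^] k = c [^] (i + r * k) \<otimes> b"
        using b c by (simp add: m_assoc bpow) (simp add: m_assoc int_pow_mult)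
      have "c [^] i \<otimes> b \<otimes> (c [^] k \<otimes> b) = c [^] i \<otimes> b \<otimes> c [^] k \<otimes> b"
        using b c by (simp add: m_assoc)
      also have "\<dots> = c [^] (i + r * k) \<otimes> (b \<otimes> b)" using b c 1 by (simp add: m_assoc)
      also have "\<dots> = c [^] (i + r * k + s)" using c s by (simp add: int_pow_mult)
      finally have 2: "c [^] i \<otimes> b \<otimes> (c [^] k \<otimes> b) = c [^] (i + r * k + s)" .
      have 3: "c [^] i \<otimes> (c [^] k \<otimes> b) = c [^] (i + k) \<otimes> b" using b c by (simp add: int_pow_mult m_assoc)
      show ?thesis using 1 2 3 c(1) by (simp add: E_def int_pow_mult)
    qed
    show "E i j = E k l \<longleftrightarrow> j = l \<and> 8 dvd i - k" for i j k l
    proof -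
      have "c [^] i \<otimes> b \<noteq> c [^] k" for i k :: int
      proof
        assume "c [^] i \<otimes> b = c [^] k"
        then have "c [^] (- i) \<otimes> (c [^] i \<otimes> b) \<in> A"
          using subgroup.m_closed[OF A Apow Apow] by simp
        then show False using b c by (simp add: int_pow_neg mult_inv_cancel_left)
      qed
      note ne = this this[symmetric]
      show ?thesis using b c ne by (cases j; cases l) (simp_all add: E_def pow_eq)
    qed
    show "\<exists>i j. g = E i j" if g: "g \<in> carrier G" for g
    proof (cases "g \<in> A")
      case True
      then show ?thesis unfolding A_def E_def by (auto intro: exI[of _ False])
    next
      case False
      then have "g \<otimes> inv b \<in> A" using subgroup_index2_mult[OF fin A A8 g _ _ ib] b by simp
      then obtain i :: int where "g \<otimes> inv b = c [^] i" unfolding A_def by blast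
      then have "g \<otimes> inv b \<otimes> b = E i True" unfolding E_def by simp
      then show ?thesis using g b by (auto simp: m_assoc)
    qed
  qed
  then show thesis using that r(1) s(1) by blast
qed

context cyclic8_extension begin

lemma E_one: "\<one> = E 0 False"
  using E_mult[of 0 False 0 False] r_cancel_one[of "E 0 False" "E 0 False"] by simp

text \<open>Conjugation by b cannot send a^4 to one, so \<open>r\<close> is odd. The second
  condition expresses that b commutes with b^2 = a^s.\<close>

lemma r_s_conditions: "odd r" "8 dvd r * s - s"
proof -
  have "E 0 True \<otimes> E 4 False \<noteq> E 0 True"
    using r_cancel_one'[of "E 0 True" "E 4 False"] E_eq by (auto simp: E_one)
  then have "\<not> 8 dvd r * 4" by (simp add: E_mult E_eq)
  then show "odd r" by (auto elim!: evenE)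
  have "(E 0 True \<otimes> E 0 True) \<otimes> E 0 True = E 0 True \<otimes> (E 0 True \<otimes> E 0 True)"
    by (intro m_assoc) auto
  then show "8 dvd r * s - s" by (simp add: E_mult E_eq dvd_diff_commute)
qed

lemma order_eq: "order G = 16"
proof -
  have "carrier G = (\<lambda>(i, j). E i j) ` ({0..7} \<times> UNIV)"
  proof
    show "carrier G \<subseteq> (\<lambda>(i, j). E i j) ` ({0..7} \<times> UNIV)"
    proof
      fix g assume "g \<in> carrier G"
      then obtain i j where "g = E i j" using E_surj by blast
      then have "g = E (i mod 8) j" using dvd_minus_mod by (simp add: E_eq)
      then show "g \<in> (\<lambda>(i, j). E i j) ` ({0..7} \<times> UNIV)"
        by (intro image_eqI[of _ _ "(i mod 8, j)"]) auto
    qed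
  qed auto
  moreover have "inj_on (\<lambda>(i, j). E i j) ({0..7} \<times> UNIV)"
    by (auto simp: inj_on_def E_eq) presburger
  ultimately show ?thesis by (simp add: order_def card_image card_cartesian_product)
qed

text \<open>The product rule sees \<open>r\<close> and \<open>s\<close> only modulo 8, so 7 may be
  written as -1 and -4 as 4.\<close>

lemma cyclic8_extension_cong:
  assumes r: "8 dvd r - r'" and s: "8 dvd s - s'"
  shows "cyclic8_extension G E r' s'"
proof unfold_locales
  fix i j k l
  have rk: "8 dvd (i + r * k) - (i + r' * k)"
    using dvd_mult2[OF r, of k] by (simp add: left_diff_distrib)
  moreover have "8 dvd (i + r * k + s) - (i + r' * k + s')"
    using dvd_add[OF rk s] by (simp add: algebra_simps)
  ultimately show "E i j \<otimes> E k l = E (i + (if j then r' * k else k) + (if j \<and> l then s' else 0)) (j \<noteq> l)"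
    unfolding E_mult E_eq by (cases j; cases l) simp_all
qed (use E_eq E_surj in auto)

lemma t_group_not_3_5:
  assumes t_group: "t_group G" and rs: "r = 3 \<or> r = 5"
  shows False
proof -
  have fin: "finite (carrier G)" using t_group by (simp add: t_group_iff)
  \<comment> \<open>As (a^i b)^2 = a^(i + r i + s), this asks for an involution outside the cyclic
    subgroup. By \<open>r_s_conditions\<close> s is 4 q for r = 3 and 2 q for r = 5; the witnesses
    -q and q make the exponent 0 and 8 q.\<close>
  have "\<exists>i. 8 dvd i + r * i + s"
  proof (cases "r = 3")
    case True
    then obtain q where "3 * s - s = 8 * q" using r_s_conditions(2) unfolding True dvd_def by blast
    then have "s = 4 * q" by linarith
    then show ?thesis using True by (intro exI[of _ "- q"]) simp
  next
    case False
    then have "r = 5" using rs by blast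
    then obtain q where "5 * s - s = 8 * q"
      using r_s_conditions(2) unfolding \<open>r = 5\<close> dvd_def by blast
    then have "s = 2 * q" by linarith
    then show ?thesis using \<open>r = 5\<close> by (intro exI[of _ q]) simp
  qed
  then obtain i where i: "8 dvd i + r * i + s" by blast
  let ?z = "E 4 False" and ?t = "E i True"
  have z: "central_involution ?z"
    unfolding central_involution_def
  proof (intro conjI ballI)
    fix g assume "g \<in> carrier G"
    then obtain k l where "g = E k l" using E_surj by blast
    moreover have "8 dvd (4 + k) - (k + r * 4)" using rs by auto
    ultimately show "?z \<otimes> g = g \<otimes> ?z" by (cases l) (simp_all add: E_mult E_eq)
  qed (simp_all add: E_mult E_eq E_one)
  have t: "?t \<otimes> ?t = \<one>" using i by (simp add: E_mult E_eq E_one)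
  have "?t \<otimes> E 1 False \<noteq> E 1 False \<otimes> ?t" 
  proof -
    have "\<not> 8 dvd (i + r) - (1 + i)" using rs by auto
    then show ?thesis by (simp add: E_mult E_eq)
  qed
  then have nc: "\<not> central_involution ?t" using central_involutionD(4) E_closed by blast
  have "?t \<noteq> \<one>" by (simp add: E_eq E_one)
  then obtain p where p: "p \<in> hom G G" "?t \<notin> p ` carrier G" "card (p ` carrier G) * 2 = order G"
    and ker: "\<And>g. g \<in> carrier G \<Longrightarrow> p g = \<one> \<longleftrightarrow> g = \<one> \<or> g = ?z"
    using t_group_noncentral_involution[OF t_group z _ _ t nc] by (metis E_closed)
  interpret p: group_hom G G p by unfold_locales (rule p(1))
  let ?K = "p ` carrier G"
  have K: "subgroup ?K G" by (rule p.img_is_subgroup)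
  \<comment> \<open>Squares lie in every subgroup of index 2. So a^2 lies in \<open>?K\<close>, and
    with it all even powers of a.\<close>
  have E2: "E 2 False \<in> ?K"
  proof (cases "E 1 False \<in> ?K")
    case True
    then show ?thesis using subgroup.m_closed[OF K True True] by (simp add: E_mult)
  next
    case False
    then show ?thesis
      using subgroup_index2_mult[OF fin K p(3) E_closed False E_closed False] by (simp add: E_mult)
  qed
  have even: "E (2 * d) False \<in> ?K" for d
  proof -
    have E4: "E 4 False \<in> ?K" using subgroup.m_closed[OF K E2 E2] by (simp add: E_mult)
    have E6: "E 6 False \<in> ?K" using subgroup.m_closed[OF K E2 E4] by (simp add: E_mult)
    have "E 0 False \<in> ?K" using subgroup.one_closed[OF K] by (simp add: E_one)
    moreover have "E (2 * d) False = E 0 False \<or> E (2 * d) False = E 2 False \<or>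
      E (2 * d) False = E 4 False \<or> E (2 * d) False = E 6 False"
      unfolding E_eq by simp presburger
    ultimately show ?thesis using E2 E4 E6 by metis
  qed
  \<comment> \<open>An involution a^m b in \<open>?K\<close> would satisfy 8 | (1 + r)(m - i) with 1
    + r equal to 4 or 6, so m - i would be even. Then \<open>?t\<close> would differ from it by an
    even power of a and lie in \<open>?K\<close>.\<close>
  have inv_K: "k = ?z" if k: "k \<in> ?K" "k \<noteq> \<one>" "k \<otimes> k = \<one>" for k
  proof -
    obtain m j where m: "k = E m j" using E_surj subgroup.mem_carrier[OF K k(1)] by blast
    show ?thesis
    proof (cases j)
      case False
      then have "8 dvd m + m" "\<not> 8 dvd m" using k m by (simp_all add: E_mult E_eq E_one)
      then have "8 dvd m - 4" by presburger
      then show ?thesis using m False by (simp add: E_eq)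
    next
      case True
      have "odd (m - i)"
      proof
        assume "even (m - i)"
        then obtain d where "m - i = 2 * d" unfolding dvd_def by blast
        then have "E (2 * (- d)) False \<otimes> k = ?t" using m True by (simp add: E_mult E_eq algebra_simps)
        then show False using p(2) subgroup.m_closed[OF K even[of "- d"] k(1)] by simp
      qed
      moreover have "8 dvd m + r * m + s" using k(3) m True by (simp add: E_mult E_eq E_one)
      then have "8 dvd (m + r * m + s) - (i + r * i + s)" using i by (rule dvd_diff)
      then have "8 dvd (1 + r) * (m - i)" by (simp add: algebra_simps)
      then have "8 dvd 4 * (m - i) \<or> 8 dvd 6 * (m - i)" using rs by auto
      ultimately have False by presburger
      then show ?thesis ..
    qed
  qed
  \<comment> \<open>Both a^2 and \<open>?t\<close> lie outside the kernel while their squares lie in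
    it, so they map to the only involution of \<open>?K\<close>. Their product would then lie in the
    kernel, but it is neither one nor a^4.\<close>
  have "p (E 2 False) = ?z"
  proof (rule inv_K)
    show "p (E 2 False) \<noteq> \<one>" using ker[of "E 2 False"] by (simp add: E_eq E_one)
    have "p (E 2 False) \<otimes> p (E 2 False) = p (E 4 False)"
      using p.hom_mult[of "E 2 False" "E 2 False"] by (simp add: E_mult)
    then show "p (E 2 False) \<otimes> p (E 2 False) = \<one>" using ker[of ?z] by simp
  qed auto
  moreover have "p ?t = ?z"
  proof (rule inv_K)
    show "p ?t \<noteq> \<one>" using ker[of ?t] by (simp add: E_eq E_one)
    show "p ?t \<otimes> p ?t = \<one>" using p.hom_mult[of ?t ?t] t by simp
  qed auto
  ultimately have "p (E 2 False \<otimes> ?t) = ?z \<otimes> ?z" using p.hom_mult[of "E 2 False" ?t] by simp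
  then have "p (E (2 + i) True) = \<one>" using z by (simp add: E_mult central_involution_def)
  then show False using ker[of "E (2 + i) True"] by (simp add: E_eq E_one)
qed

end

text \<open>Oddness leaves r = 1, 3, 5, 7; r = 1 makes \<open>G\<close> abelian, and 3 and 5 are
  excluded. For r = 7 the condition on \<open>s\<close> reads 8 | 6 s.\<close>

lemma (in group) t_group_cyclic8_extension:
  assumes t_group: "t_group G" and ord: "order G = 16"
    and noncomm: "\<exists>g\<in>carrier G. \<exists>h\<in>carrier G. g \<otimes> h \<noteq> h \<otimes> g"
  shows "\<exists>E. cyclic8_extension G E (-1) 0 \<or> cyclic8_extension G E (-1) 4"
proof -
  obtain a where "a \<in> carrier G" "(a \<otimes> a) \<otimes> (a \<otimes> a) \<noteq> \<one>"
    using t_group_exponent[OF t_group ord noncomm] by blast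
  then obtain E r s where E: "cyclic8_extension G E r s" and rs: "r \<in> {0..7}" "s \<in> {0..7}"
    using exists_cyclic8_extension[OF ord] by metis
  interpret E: cyclic8_extension G E r s by fact
  have r35: "\<not> (r = 3 \<or> r = 5)" using E.t_group_not_3_5[OF t_group] by blast
  have r1: "r \<noteq> 1"
  proof
    assume "r = 1"
    have "g \<otimes> h = h \<otimes> g" if gh: "g \<in> carrier G" "h \<in> carrier G" for g h
    proof -
      obtain i j k l where "g = E i j" "h = E k l" using E.E_surj gh by metis
      then show ?thesis using \<open>r = 1\<close> by (auto simp: E.E_mult E.E_eq algebra_simps)
    qed
    then show False using noncomm by blast
  qed
  have "r = 0 \<or> r = 1 \<or> r = 2 \<or> r = 3 \<or> r = 4 \<or> r = 5 \<or> r = 6 \<or> r = 7" using rs by auto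
  then have r7: "r = 7" using r35 r1 E.r_s_conditions(1) by auto
  have "s = 0 \<or> s = 1 \<or> s = 2 \<or> s = 3 \<or> s = 4 \<or> s = 5 \<or> s = 6 \<or> s = 7" using rs by auto
  then have "s = 0 \<or> s = 4" using E.r_s_conditions(2) r7 by auto
  then show ?thesis using E.cyclic8_extension_cong[of "-1" s] r7 by auto
qed

section \<open>Dihedral and dicyclic presentations\<close>

definition word_inv :: "'g word \<Rightarrow> 'g word" where
  "word_inv w = map (\<lambda>(x, e). (x, \<not> e)) (rev w)"

lemma equiv_pres_rel: "equiv UNIV (pres_rel R)"
  by (intro equivI refl_onI symI transI) (auto intro: pres_rel.intros)

lemma pres_rel_context: "(u, v) \<in> pres_rel R \<Longrightarrow> (x @ u @ y, x @ v @ y) \<in> pres_rel R"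
proof (induction rule: pres_rel.induct)
  case (cancel u g e v)
  then show ?case using pres_rel.cancel[of "x @ u" g e "v @ y"] by simp
next
  case (relator r u v)
  then show ?case using pres_rel.relator[of r R "x @ u" "v @ y"] by simp
qed (blast intro: pres_rel.intros)+

lemma pres_rel_append:
  assumes "(u, u') \<in> pres_rel R" "(v, v') \<in> pres_rel R"
  shows "(u @ v, u' @ v') \<in> pres_rel R"
  using pres_rel_context[OF assms(1), of "[]" v] pres_rel_context[OF assms(2), of u' "[]"]
  by (auto intro: pres_rel.trans)

lemma pres_rel_class_eq: "pres_rel R `` {u} = pres_rel R `` {v} \<longleftrightarrow> (u, v) \<in> pres_rel R"
  using eq_equiv_class_iff[OF equiv_pres_rel] by blast

lemma pres_rel_word_inv: "(word_inv w @ w, []) \<in> pres_rel R"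
proof (induction w)
  case Nil
  show ?case by (simp add: word_inv_def pres_rel.refl)
next
  case (Cons g w)
  obtain x e where g: "g = (x, e)" by (cases g) auto
  have "(word_inv w @ [(x, \<not> e), (x, \<not> \<not> e)] @ w, word_inv w @ w) \<in> pres_rel R"
    by (rule pres_rel.cancel)
  then show ?case using Cons pres_rel.trans by (fastforce simp: word_inv_def g)
qed

text \<open>\<open>pres_rel\<close> is a congruence, so the union over representatives runs over a
  constant nonempty family.\<close>

lemma presented_group_mult:
  "(pres_rel R `` {u}) \<otimes>\<^bsub>presented_group R\<^esub> (pres_rel R `` {v}) = pres_rel R `` {u @ v}"
proof -
  have const: "pres_rel R `` {u' @ v'} = pres_rel R `` {u @ v}"
    if "u' \<in> pres_rel R `` {u}" "v' \<in> pres_rel R `` {v}" for u' v'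
    using that pres_rel_append[of u u' R v v'] pres_rel_class_eq[of R "u @ v" "u' @ v'"] by simp
  have "(\<Union>u'\<in>pres_rel R `` {u}. \<Union>v'\<in>pres_rel R `` {v}. pres_rel R `` {u' @ v'}) =
    (\<Union>u'\<in>pres_rel R `` {u}. \<Union>v'\<in>pres_rel R `` {v}. pres_rel R `` {u @ v})"
    by (intro SUP_cong HOL.refl const)
  also have "\<dots> = pres_rel R `` {u @ v}"
  proof -
    have "u \<in> pres_rel R `` {u}" "v \<in> pres_rel R `` {v}" by (simp_all add: pres_rel.refl)
    then show ?thesis by blast
  qed
  finally show ?thesis by (simp add: presented_group_def)
qed

lemma carrier_presented_group: "carrier (presented_group R) = range (\<lambda>w. pres_rel R `` {w})"
  by (auto simp: presented_group_def quotient_def)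

lemma one_presented_group: "\<one>\<^bsub>presented_group R\<^esub> = pres_rel R `` {[]}"
  by (simp add: presented_group_def)

lemma group_presented_group: "group (presented_group R)"
proof (rule groupI)
  fix x assume "x \<in> carrier (presented_group R)"
  then obtain w where "x = pres_rel R `` {w}" by (auto simp: carrier_presented_group)
  then show "\<exists>y\<in>carrier (presented_group R). y \<otimes>\<^bsub>presented_group R\<^esub> x = \<one>\<^bsub>presented_group R\<^esub>"
    using pres_rel_word_inv[of w R]
    by (intro bexI[of _ "pres_rel R `` {word_inv w}"])
      (auto simp: presented_group_mult one_presented_group pres_rel_class_eq carrier_presented_group)
qed (auto simp: carrier_presented_group presented_group_mult one_presented_group)

lemma presented_group_wpow:
  "pres_rel R `` {wpow w n} = (pres_rel R `` {w}) [^]\<^bsub>presented_group R\<^esub> n"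
proof -
  interpret group "presented_group R" by (rule group_presented_group)
  have w: "pres_rel R `` {w} \<in> carrier (presented_group R)" by (simp add: carrier_presented_group)
  show ?thesis
  proof (induction n)
    case 0
    show ?case by (simp add: wpow_def one_presented_group)
  next
    case (Suc n)
    have "wpow w (Suc n) = w @ wpow w n" by (simp add: wpow_def)
    then show ?case using Suc nat_pow_Suc2[OF w, of n] by (simp flip: presented_group_mult)
  qed
qed

section \<open>Evaluation of words and homomorphisms from presented groups\<close>

definition (in group) eval_word :: "('g \<Rightarrow> 'a) \<Rightarrow> 'g word \<Rightarrow> 'a" where
  "eval_word f w = foldr (\<lambda>(x, e) y. (if e then f x else inv (f x)) \<otimes> y) w \<one>"

context group begin

lemma eval_word_simps [simp]:
  "eval_word f [] = \<one>"
  "eval_word f ((x, e) # w) = (if e then f x else inv (f x)) \<otimes> eval_word f w"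
  by (simp_all add: eval_word_def)

lemma eval_word_closed:
  assumes "range f \<subseteq> carrier G"
  shows "eval_word f w \<in> carrier G"
proof (induction w)
  case (Cons g w)
  have "f x \<in> carrier G" for x using assms by blast
  then show ?case using Cons by (cases g) simp
qed simp

lemma eval_word_append:
  assumes f: "range f \<subseteq> carrier G"
  shows "eval_word f (u @ v) = eval_word f u \<otimes> eval_word f v"
proof (induction u)
  case Nil
  show ?case using eval_word_closed[OF f] by simp
next
  case (Cons g u)
  have "f x \<in> carrier G" for x using f by blast
  then show ?case using Cons eval_word_closed[OF f] by (cases g) (simp add: m_assoc)
qed

lemma eval_word_wpow:
  assumes f: "range f \<subseteq> carrier G"
  shows "eval_word f (wpow w n) = eval_word f w [^] n"
proof (induction n)
  case 0
  show ?case by (simp add: wpow_def)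
next
  case (Suc n)
  have "wpow w (Suc n) = w @ wpow w n" by (simp add: wpow_def)
  then show ?case using Suc nat_pow_Suc2[of "eval_word f w" n] eval_word_closed[OF f, of w]
    by (simp add: eval_word_append[OF f])
qed

lemma eval_word_pres_rel:
  assumes f: "range f \<subseteq> carrier G" and R: "\<And>r. r \<in> R \<Longrightarrow> eval_word f r = \<one>"
    and "(u, v) \<in> pres_rel R"
  shows "eval_word f u = eval_word f v"
  using assms(3)
proof (induction rule: pres_rel.induct)
  case (cancel u x e v)
  have "f x \<in> carrier G" using f by blast
  then have "eval_word f [(x, e), (x, \<not> e)] = \<one>" by (cases e) simp_all
  then show ?case using eval_word_closed[OF f] by (simp only: eval_word_append[OF f] l_one)
next
  case (relator r u v)
  then show ?case using R eval_word_closed[OF f] by (simp add: eval_word_append[OF f])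
qed simp_all

text \<open>Evaluation is constant on the classes of \<open>pres_rel\<close>, so an arbitrarily
  chosen representative gives the value. This is the universal property of the presentation.\<close>

lemma von_Dyck:
  assumes f: "range f \<subseteq> carrier G" and R: "\<And>r. r \<in> R \<Longrightarrow> eval_word f r = \<one>"
  obtains h where "h \<in> hom (presented_group R) G"
    "\<And>w. h (pres_rel R `` {w}) = eval_word f w"
proof -
  define h where "h A = eval_word f (SOME w. w \<in> A)" for A
  have h: "h (pres_rel R `` {w}) = eval_word f w" for w
  proof -
    have "w \<in> pres_rel R `` {w}" by (simp add: pres_rel.refl)
    then have "(SOME v. v \<in> pres_rel R `` {w}) \<in> pres_rel R `` {w}" by (rule someI)
    then show ?thesis unfolding h_def using eval_word_pres_rel[OF f R] by simp
  qed
  show thesis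
  proof (rule that[OF _ h], rule homI)
    fix x y assume "x \<in> carrier (presented_group R)" "y \<in> carrier (presented_group R)"
    then obtain u v where "x = pres_rel R `` {u}" "y = pres_rel R `` {v}"
      by (auto simp: carrier_presented_group)
    then show "h x \<in> carrier G" and "h (x \<otimes>\<^bsub>presented_group R\<^esub> y) = h x \<otimes> h y"
      using eval_word_closed[OF f] by (simp_all add: presented_group_mult h eval_word_append[OF f])
  qed
qed

end

definition dihedral_presentation :: "nat \<Rightarrow> gen word set" where
  "dihedral_presentation k = {wpow wa 8, wpow wa k @ wpow wb 2, wa @ wb @ wa @ wb_inv}"

text \<open>\<open>wpow wa 0\<close> is the empty word, so k = 0 leaves the relator b^2. One
  parameter thus treats both presentations together.\<close>

lemma D16_eq: "D16 = presented_group (dihedral_presentation 0)"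
  and Q16_eq: "Q16 = presented_group (dihedral_presentation 4)"
  by (simp_all add: D16_def Q16_def dihedral_presentation_def wpow_def)

text \<open>The class of an inverse letter is the group inverse of a generator, so induction on
  words suffices.\<close>

lemma presented_generated:
  fixes R :: "gen word set"
  defines "Q \<equiv> presented_group R"
  assumes H: "subgroup H Q" and ab: "pres_rel R `` {wa} \<in> H" "pres_rel R `` {wb} \<in> H"
  shows "H = carrier Q"
proof -
  interpret Q: group Q unfolding Q_def by (rule group_presented_group)
  have letter: "pres_rel R `` {[(x, e)]} \<in> H" for x e
  proof -
    have pos: "pres_rel R `` {[(x, True)]} \<in> H" using ab by (cases x) auto
    show ?thesis
    proof (cases e)
      case False
      have "([(x, False), (x, True)], []) \<in> pres_rel R"
        using pres_rel.cancel[of "[]" x False "[]"] by simp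
      then have "pres_rel R `` {[(x, False)]} \<otimes>\<^bsub>Q\<^esub> pres_rel R `` {[(x, True)]} = \<one>\<^bsub>Q\<^esub>"
        unfolding Q_def presented_group_mult one_presented_group pres_rel_class_eq by simp
      then have "pres_rel R `` {[(x, False)]} = inv\<^bsub>Q\<^esub> (pres_rel R `` {[(x, True)]})"
        by (intro Q.inv_equality[symmetric]) (auto simp: Q_def carrier_presented_group)
      then show ?thesis using subgroup.m_inv_closed[OF H pos] False by simp
    qed (use pos in simp)
  qed
  have "pres_rel R `` {w} \<in> H" for w
  proof (induction w)
    case Nil
    show ?case using subgroup.one_closed[OF H] by (simp add: Q_def one_presented_group)
  next
    case (Cons g w)
    have "pres_rel R `` {g # w} = pres_rel R `` {[g]} \<otimes>\<^bsub>Q\<^esub> pres_rel R `` {w}"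
      by (simp add: Q_def presented_group_mult)
    then show ?case using subgroup.m_closed[OF H _ Cons] letter by (cases g) simp
  qed
  then show ?thesis using subgroup.subset[OF H] by (auto simp: Q_def carrier_presented_group)
qed

text \<open>The relation a b a = b moves powers of a past b, and b^2 is a power of a. So the
  elements a^i and a^i b form a subgroup containing the generators, which bounds the order by 16.
  When the bound is attained, the 16 normal forms are distinct, which supplies
  \<open>E_eq\<close>.\<close>

lemma (in group) dihedral_normal_form:
  assumes a: "a \<in> carrier G" and b: "b \<in> carrier G" and a8: "a [^] (8::nat) = \<one>"
    and b2: "a [^] (k::nat) \<otimes> (b \<otimes> b) = \<one>" and aba: "a \<otimes> b \<otimes> a = b"
    and gen: "\<And>H. \<lbrakk>subgroup H G; a \<in> H; b \<in> H\<rbrakk> \<Longrightarrow> H = carrier G"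
  defines "E \<equiv> \<lambda>i j. a [^] (i::int) \<otimes> (if j then b else \<one>)"
  shows "finite (carrier G)" "order G \<le> 16"
    and "order G = 16 \<Longrightarrow> cyclic8_extension G E (-1) (- int k)"
proof -
  have Ec [simp]: "E i j \<in> carrier G" for i j unfolding E_def using a b by simp
  have conj: "b \<otimes> a = a [^] (-1::int) \<otimes> b"
  proof -
    have "inv a \<otimes> (a \<otimes> b \<otimes> a) = inv a \<otimes> b" using aba by simp
    then show ?thesis using a b by (simp add: m_assoc mult_inv_cancel_left int_pow_neg)
  qed
  note bpow = conj_int_pow[OF b a conj]
  have bb: "b \<otimes> b = a [^] (- int k)"
    using inv_equality[OF b2] a b by (metis int_pow_int int_pow_neg inv_inv m_closed nat_pow_closed)
  have mult: "E i j \<otimes> E m l = E (i + (if j then -1 * m else m) + (if j \<and> l then - int k else 0)) (j \<noteq> l)"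
    for i j m l
  proof -
    have 1: "a [^] i \<otimes> b \<otimes> a [^] m = a [^] (i - m) \<otimes> b"
    proof -
      have "a [^] i \<otimes> b \<otimes> a [^] m = a [^] i \<otimes> (b \<otimes> a [^] m)" using a b by (simp add: m_assoc)
      also have "\<dots> = a [^] i \<otimes> a [^] (-1 * m) \<otimes> b" unfolding bpow using a b by (simp add: m_assoc)
      finally show ?thesis using int_pow_mult[OF a, of i "-1 * m"] by simp
    qed
    have "a [^] i \<otimes> b \<otimes> (a [^] m \<otimes> b) = a [^] i \<otimes> b \<otimes> a [^] m \<otimes> b" using a b by (simp add: m_assoc)
    also have "\<dots> = a [^] (i - m) \<otimes> (b \<otimes> b)" unfolding 1 using a b by (simp add: m_assoc)
    also have "\<dots> = a [^] (i - m + (- int k))" unfolding bb using a by (simp only: int_pow_mult)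
    finally have 2: "a [^] i \<otimes> b \<otimes> (a [^] m \<otimes> b) = a [^] (i - m + (- int k))" .
    have 3: "a [^] i \<otimes> (a [^] m \<otimes> b) = a [^] (i + m) \<otimes> b" using a b by (simp add: int_pow_mult m_assoc)
    have 4: "a [^] i \<otimes> a [^] m = a [^] (i + m)" using a by (simp add: int_pow_mult)
    show ?thesis using 1 2 3 4 a b by (cases j; cases l) (simp_all add: E_def)
  qed
  have E0: "E 0 False = \<one>" "E 1 False = a" "E 0 True = b" unfolding E_def using a b by simp_all
  have "subgroup (range (\<lambda>(i, j). E i j)) G"
  proof (rule subgroupI)
    fix x y assume "x \<in> range (\<lambda>(i, j). E i j)" "y \<in> range (\<lambda>(i, j). E i j)"
    then obtain i j m l where ij: "x = E i j" "y = E m l" by auto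
    show "x \<otimes> y \<in> range (\<lambda>(i, j). E i j)" unfolding ij mult by auto
    have "E (if j then i + int k else - i) j \<otimes> E i j = \<one>"
      unfolding mult E0(1)[symmetric] by (cases j) simp_all
    then have "inv x = E (if j then i + int k else - i) j" unfolding ij by (simp add: inv_equality)
    then show "inv x \<in> range (\<lambda>(i, j). E i j)" by auto
  qed auto
  moreover have "a \<in> range (\<lambda>(i, j). E i j)" "b \<in> range (\<lambda>(i, j). E i j)"
    unfolding E0(2,3)[symmetric] by auto
  ultimately have range: "range (\<lambda>(i, j). E i j) = carrier G" by (rule gen)
  have period: "E i j = E l j" if "8 dvd i - l" for i l j
  proof -
    have "ord a dvd 8" using a8 pow_eq_id[OF a] by blast
    then have "int (ord a) dvd 8" by (metis int_dvd_int_iff of_nat_numeral)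
    then have "int (ord a) dvd l - i" using that by (metis dvd_diff_commute dvd_trans)
    then show ?thesis unfolding E_def using int_pow_eq[OF a, of i l] by simp
  qed
  have surj: "carrier G = (\<lambda>(i, j). E i j) ` ({0..7} \<times> UNIV)"
  proof
    show "carrier G \<subseteq> (\<lambda>(i, j). E i j) ` ({0..7} \<times> UNIV)"
    proof
      fix g assume "g \<in> carrier G"
      then have "g \<in> range (\<lambda>(i, j). E i j)" using range by simp
      then obtain i j where "g = E i j" by auto
      then have "g = E (i mod 8) j" using period dvd_minus_mod by blast
      then show "g \<in> (\<lambda>(i, j). E i j) ` ({0..7} \<times> UNIV)"
        by (intro image_eqI[of _ _ "(i mod 8, j)"]) auto
    qed
  qed auto
  have card16: "card ({0..7::int} \<times> (UNIV :: bool set)) = 16" by (simp add: card_cartesian_product)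
  show "finite (carrier G)" unfolding surj by simp
  show "order G \<le> 16"
    unfolding order_def surj using card_image_le[of "{0..7::int} \<times> (UNIV :: bool set)"] card16 by fastforce
  assume "order G = 16"
  then have inj: "inj_on (\<lambda>(i, j). E i j) ({0..7} \<times> UNIV)"
    using card16 unfolding order_def surj by (intro eq_card_imp_inj_on) auto
  show "cyclic8_extension G E (-1) (- int k)"
  proof (unfold_locales)
    show "E i j = E m l \<longleftrightarrow> j = l \<and> 8 dvd i - m" for i j m l
    proof
      assume "E i j = E m l"
      then have "E (i mod 8) j = E (m mod 8) l"
        using period[OF dvd_minus_mod, of i j] period[OF dvd_minus_mod, of m l] by simp
      then have "(i mod 8, j) = (m mod 8, l)" using inj_onD[OF inj, of "(i mod 8, j)" "(m mod 8, l)"] by simp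
      then show "j = l \<and> 8 dvd i - m" by (simp add: mod_eq_dvd_iff)
    qed (use period in blast)
    show "\<exists>i j. g = E i j" if "g \<in> carrier G" for g
    proof -
      have "g \<in> range (\<lambda>(i, j). E i j)" using range that by simp
      then show ?thesis by auto
    qed
  qed (use mult in simp_all)
qed

text \<open>The relators alone give an upper bound for the order. That it is attained follows once
  an isomorphism with, or a surjection onto, a group of order 16 is at hand.\<close>

lemma presented_normal_form:
  fixes k :: nat
  defines "Q \<equiv> presented_group (dihedral_presentation k)"
  shows "finite (carrier Q)" "order Q \<le> 16"
    and "order Q = 16 \<Longrightarrow> \<exists>E. cyclic8_extension Q E (-1) (- int k)"
proof -
  interpret Q: group Q unfolding Q_def by (rule group_presented_group)
  let ?R = "dihedral_presentation k"
  let ?a = "pres_rel ?R `` {wa}" and ?b = "pres_rel ?R `` {wb}"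
  have rel: "pres_rel ?R `` {r} = \<one>\<^bsub>Q\<^esub>" if "r \<in> ?R" for r
    unfolding Q_def one_presented_group pres_rel_class_eq
    using pres_rel.relator[OF that, of "[]" "[]"] by simp
  have ab: "?a \<in> carrier Q" "?b \<in> carrier Q" unfolding Q_def carrier_presented_group by auto
  have a8: "?a [^]\<^bsub>Q\<^esub> (8::nat) = \<one>\<^bsub>Q\<^esub>"
    using rel[of "wpow wa 8"] unfolding Q_def presented_group_wpow by (simp add: dihedral_presentation_def)
  have "pres_rel ?R `` {wpow wb 2} = ?b \<otimes>\<^bsub>Q\<^esub> ?b"
    unfolding Q_def presented_group_mult by (simp add: wpow_def numeral_2_eq_2)
  moreover have "pres_rel ?R `` {wpow wa k @ wpow wb 2} = \<one>\<^bsub>Q\<^esub>"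
    by (rule rel) (simp add: dihedral_presentation_def)
  ultimately have b2: "?a [^]\<^bsub>Q\<^esub> k \<otimes>\<^bsub>Q\<^esub> (?b \<otimes>\<^bsub>Q\<^esub> ?b) = \<one>\<^bsub>Q\<^esub>"
    unfolding Q_def by (simp flip: presented_group_mult presented_group_wpow)
  \<comment> \<open>Appending b to the relator a b a b^-1 cancels its last letter and gives the
    equation a b a = b.\<close>
  have "(wa @ wb @ wa @ [(Gen_b, False), (Gen_b, \<not> False)] @ [], wa @ wb @ wa @ []) \<in> pres_rel ?R"
    using pres_rel.cancel[of "wa @ wb @ wa" Gen_b False "[]"] by simp
  then have "pres_rel ?R `` {(wa @ wb @ wa @ wb_inv) @ wb} = pres_rel ?R `` {wa @ wb @ wa}"
    unfolding pres_rel_class_eq by simp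
  moreover have "pres_rel ?R `` {wa @ wb @ wa @ wb_inv} = \<one>\<^bsub>Q\<^esub>"
    by (rule rel) (simp add: dihedral_presentation_def)
  ultimately have "\<one>\<^bsub>Q\<^esub> \<otimes>\<^bsub>Q\<^esub> ?b = ?a \<otimes>\<^bsub>Q\<^esub> ?b \<otimes>\<^bsub>Q\<^esub> ?a"
    unfolding Q_def by (metis presented_group_mult append_assoc)
  then have aba: "?a \<otimes>\<^bsub>Q\<^esub> ?b \<otimes>\<^bsub>Q\<^esub> ?a = ?b" using ab by simp
  note nf = Q.dihedral_normal_form[OF ab a8 b2 aba presented_generated[of _ ?R, folded Q_def]]
  show "finite (carrier Q)" "order Q \<le> 16" "order Q = 16 \<Longrightarrow> \<exists>E. cyclic8_extension Q E (-1) (- int k)"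
    using nf by blast+
qed

lemma cyclic8_extension_iso:
  assumes "cyclic8_extension Q E r s" "group G" "h \<in> iso Q G"
  shows "cyclic8_extension G (\<lambda>i j. h (E i j)) r s"
proof -
  interpret Q: cyclic8_extension Q E r s by fact
  interpret G: group G by fact
  have bij: "bij_betw h (carrier Q) (carrier G)" using assms(3) by (simp add: iso_def)
  have hom: "h \<in> hom Q G" using assms(3) by (simp add: iso_def)
  show ?thesis
  proof unfold_locales
    show "h (E i j) \<in> carrier G" for i j using hom by (auto simp: hom_def)
    show "h (E i j) \<otimes>\<^bsub>G\<^esub> h (E k l) = h (E (i + (if j then r * k else k) + (if j \<and> l then s else 0)) (j \<noteq> l))"
      for i j k l
      using hom_mult[OF hom Q.E_closed Q.E_closed, of i j k l] Q.E_mult by metis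
    show "h (E i j) = h (E k l) \<longleftrightarrow> j = l \<and> 8 dvd i - k" for i j k l
      using bij_betw_imp_inj_on[OF bij] Q.E_eq[of i j k l] by (metis Q.E_closed inj_on_eq_iff)
    show "\<exists>i j. g = h (E i j)" if "g \<in> carrier G" for g
      using that bij Q.E_surj unfolding bij_betw_def by (metis image_iff)
  qed
qed

text \<open>From left to right the normal form is transported along an isomorphism. Conversely, von
  Dyck's theorem gives a homomorphism from the presented group onto \<open>G\<close>, and the bound
  16 on its order makes it injective.\<close>

lemma iso_presented_iff:
  assumes "group G" "order G = 16" and k: "k = 0 \<or> k = 4"
  shows "G \<cong> presented_group (dihedral_presentation k) \<longleftrightarrow> (\<exists>E. cyclic8_extension G E (-1) (int k))"
proof
  let ?R = "dihedral_presentation k"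
  let ?Q = "presented_group ?R"
  interpret Q: group ?Q by (rule group_presented_group)
  interpret G: group G by fact
  show "\<exists>E. cyclic8_extension G E (-1) (int k)" if iso: "G \<cong> ?Q"
  proof -
    have "order ?Q = 16" using iso_same_card[OF iso] assms(2) by (simp add: order_def)
    then obtain E where "cyclic8_extension ?Q E (-1) (- int k)" using presented_normal_form(3) by blast
    moreover obtain h where "h \<in> iso ?Q G"
      using iso G.iso_set_sym unfolding is_iso_def by blast
    ultimately have "cyclic8_extension G (\<lambda>i j. h (E i j)) (-1) (- int k)"
      using cyclic8_extension_iso[OF _ assms(1)] by blast
    \<comment> \<open>The presentation yields b^2 = a^(-k), and k and -k agree modulo 8 for k = 0
      and k = 4.\<close>
    then have "cyclic8_extension G (\<lambda>i j. h (E i j)) (-1) (int k)"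
      by (rule cyclic8_extension.cyclic8_extension_cong) (use k in auto)
    then show ?thesis by blast
  qed
  assume "\<exists>E. cyclic8_extension G E (-1) (int k)"
  then obtain E where "cyclic8_extension G E (-1) (int k)" by blast
  then interpret E: cyclic8_extension G E "-1" "int k" .
  define f where "f x = (case x of Gen_a \<Rightarrow> E 1 False | Gen_b \<Rightarrow> E 0 True)" for x
  have "f x \<in> carrier G" for x unfolding f_def by (cases x) simp_all
  then have f: "range f \<subseteq> carrier G" by blast
  have fa: "G.eval_word f wa = E 1 False" and fb: "G.eval_word f wb = E 0 True"
    and fbi: "G.eval_word f wb_inv = inv\<^bsub>G\<^esub> E 0 True" by (simp_all add: f_def)
  have pow: "E 1 False [^]\<^bsub>G\<^esub> n = E (int n) False" for n :: nat
    by (induction n) (simp_all add: E.E_one E.E_mult algebra_simps)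
  have rel: "G.eval_word f w = \<one>\<^bsub>G\<^esub>" if "w \<in> ?R" for w
  proof -
    have "G.eval_word f (wpow wa 8) = \<one>\<^bsub>G\<^esub>"
      unfolding G.eval_word_wpow[OF f] fa pow by (simp add: E.E_one E.E_eq)
    moreover have "G.eval_word f (wpow wa k @ wpow wb 2) = \<one>\<^bsub>G\<^esub>"
      unfolding G.eval_word_append[OF f] G.eval_word_wpow[OF f] fa fb pow
      using k by (auto simp: numeral_2_eq_2 E.E_one E.E_eq E.E_mult)
    moreover have "G.eval_word f (wa @ wb @ wa @ wb_inv) = \<one>\<^bsub>G\<^esub>"
    proof -
      have "G.eval_word f (wa @ wb @ wa @ wb_inv) =
        (E 1 False \<otimes>\<^bsub>G\<^esub> E 0 True \<otimes>\<^bsub>G\<^esub> E 1 False) \<otimes>\<^bsub>G\<^esub> inv\<^bsub>G\<^esub> E 0 True"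
        unfolding G.eval_word_append[OF f] fa fb fbi by (simp add: G.m_assoc)
      also have "E 1 False \<otimes>\<^bsub>G\<^esub> E 0 True \<otimes>\<^bsub>G\<^esub> E 1 False = E 0 True" by (simp add: E.E_mult)
      finally show ?thesis by simp
    qed
    ultimately show ?thesis using that unfolding dihedral_presentation_def by blast
  qed
  obtain h where hom: "h \<in> hom ?Q G" and h: "\<And>w. h (pres_rel ?R `` {w}) = G.eval_word f w"
    using G.von_Dyck[OF f rel] by blast
  have surj: "h ` carrier ?Q = carrier G"
  proof
    show "carrier G \<subseteq> h ` carrier ?Q"
    proof
      fix g assume "g \<in> carrier G"
      then obtain i j where g: "g = E i j" using E.E_surj by blast
      \<comment> \<open>Reducing the exponent modulo 8 makes it nonnegative, so that a power of the
        letter a represents it.\<close>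
      let ?w = "wpow wa (nat (i mod 8)) @ (if j then wb else [])"
      have "G.eval_word f ?w = E (i mod 8) j"
        unfolding G.eval_word_append[OF f] G.eval_word_wpow[OF f] fa pow
        by (cases j) (simp_all add: f_def E.E_mult)
      also have "\<dots> = g" unfolding g E.E_eq using dvd_minus_mod[of 8 i] by (simp add: dvd_diff_commute)
      finally have "g = h (pres_rel ?R `` {?w})" using h by simp
      then show "g \<in> h ` carrier ?Q" unfolding carrier_presented_group by blast
    qed
  qed (use hom in \<open>auto simp: hom_def\<close>)
  have "inj_on h (carrier ?Q)"
  proof (rule eq_card_imp_inj_on[OF presented_normal_form(1)])
    have "card (h ` carrier ?Q) = 16" using surj assms(2) by (simp add: order_def)
    moreover have "card (h ` carrier ?Q) \<le> card (carrier ?Q)"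
      by (rule card_image_le[OF presented_normal_form(1)])
    ultimately show "card (h ` carrier ?Q) = card (carrier ?Q)"
      using presented_normal_form(2)[of k] by (simp add: order_def)
  qed
  then have "h \<in> iso ?Q G" using hom surj by (simp add: iso_def bij_betw_def)
  then show "G \<cong> ?Q" using Q.iso_set_sym is_isoI by blast
qed

section \<open>Loops in the dihedral and dicyclic groups\<close>

text \<open>Loops need not be groups. To invert an isomorphism it is enough that products stay in
  the domain, where \<open>f\<close> is injective.\<close>

lemma iso_sym_closed:
  assumes f: "f \<in> iso A B" and closed: "\<And>x y. \<lbrakk>x \<in> carrier A; y \<in> carrier A\<rbrakk> \<Longrightarrow> x \<otimes>\<^bsub>A\<^esub> y \<in> carrier A"
  shows "inv_into (carrier A) f \<in> iso B A"
proof -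
  let ?g = "inv_into (carrier A) f"
  have bij: "bij_betw f (carrier A) (carrier B)" using f by (simp add: iso_def)
  have g: "?g y \<in> carrier A" "f (?g y) = y" if "y \<in> carrier B" for y
    using bij that by (auto simp: bij_betw_def inv_into_into f_inv_into_f)
  have "?g (x \<otimes>\<^bsub>B\<^esub> y) = ?g x \<otimes>\<^bsub>A\<^esub> ?g y" if xy: "x \<in> carrier B" "y \<in> carrier B" for x y
  proof -
    have "f (?g x \<otimes>\<^bsub>A\<^esub> ?g y) = x \<otimes>\<^bsub>B\<^esub> y"
      using f g[OF xy(1)] g[OF xy(2)] by (simp add: iso_def hom_def)
    then show ?thesis
      using inv_into_f_f[OF bij_betw_imp_inj_on[OF bij] closed[OF g(1)[OF xy(1)] g(1)[OF xy(2)]]] by simp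
  qed
  then show ?thesis using bij_betw_inv_into[OF bij] g by (intro isoI homI) auto
qed

context group begin

text \<open>Edges are found by comparing both subgroups with one model \<open>L\<close>.\<close>

definition has_loop :: "'a set \<Rightarrow> 'c monoid \<Rightarrow> bool" where
  "has_loop H L \<longleftrightarrow> (\<exists>S \<in> NRT G H. L \<cong> right_loop G H S)"

lemma has_loop_common:
  assumes HK: "has_loop H L" "has_loop K L"
    and closed: "\<And>x y. \<lbrakk>x \<in> carrier L; y \<in> carrier L\<rbrakk> \<Longrightarrow> x \<otimes>\<^bsub>L\<^esub> y \<in> carrier L"
  shows "\<exists>S \<in> NRT G H. \<exists>T \<in> NRT G K. right_loop G H S \<cong> right_loop G K T"
proof -
  obtain S f where S: "S \<in> NRT G H" "f \<in> iso L (right_loop G H S)"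
    using HK(1) unfolding has_loop_def is_iso_def by blast
  obtain T g where T: "T \<in> NRT G K" "g \<in> iso L (right_loop G K T)"
    using HK(2) unfolding has_loop_def is_iso_def by blast
  have "g \<circ> inv_into (carrier L) f \<in> iso (right_loop G H S) (right_loop G K T)"
    using iso_set_trans[OF iso_sym_closed[OF S(2) closed] T(2)] by simp
  then show ?thesis using S(1) T(1) is_isoI by blast
qed

text \<open>The values of \<open>f\<close> serve as the transversal: \<open>inj\<close> puts them in
  different cosets of \<open>H\<close>, and by the cardinality assumption they then meet every
  coset. The last assumption turns the product of \<open>L\<close> into the loop product.\<close>

lemma has_loopI:
  assumes fin: "finite (carrier G)" and H: "subgroup H G"
    and L: "finite (carrier L)" "card (carrier L) * card H = order G"
    and f: "\<And>x. x \<in> carrier L \<Longrightarrow> f x \<in> carrier G" and e: "e \<in> carrier L" "f e = \<one>"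
    and inj: "\<And>x y. \<lbrakk>x \<in> carrier L; y \<in> carrier L; f x \<otimes> inv (f y) \<in> H\<rbrakk> \<Longrightarrow> x = y"
    and mult: "\<And>x y. \<lbrakk>x \<in> carrier L; y \<in> carrier L\<rbrakk> \<Longrightarrow> x \<otimes>\<^bsub>L\<^esub> y \<in> carrier L"
      "\<And>x y. \<lbrakk>x \<in> carrier L; y \<in> carrier L\<rbrakk> \<Longrightarrow> f (x \<otimes>\<^bsub>L\<^esub> y) \<otimes> inv (f x \<otimes> f y) \<in> H"
  shows "has_loop H L"
proof -
  interpret H: subgroup H G by (rule H)
  let ?S = "f ` carrier L"
  have inj_f: "inj_on f (carrier L)"
  proof (rule inj_onI)
    fix x y assume "x \<in> carrier L" "y \<in> carrier L" "f x = f y"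
    then show "x = y" using inj[of x y] f H.one_closed by simp
  qed
  have "(\<lambda>x. H #> f x) ` carrier L = rcosets H"
  proof (rule card_subset_eq)
    show "finite (rcosets H)" using fin by (simp add: RCOSETS_def)
    show "(\<lambda>x. H #> f x) ` carrier L \<subseteq> rcosets H" using f rcosetsI[OF H.subset] by blast
    have "inj_on (\<lambda>x. H #> f x) (carrier L)"
      by (rule inj_onI) (use inj f rcos_eq_iff[OF H] in blast)
    then have "card ((\<lambda>x. H #> f x) ` carrier L) = card (carrier L)" by (rule card_image)
    moreover have "card (carrier L) * card H = card (rcosets H) * card H"
      using lagrange_finite[OF fin H] L(2) by simp
    moreover have "card H > 0"
      using H.one_closed finite_subset[OF H.subset fin] card_gt_0_iff by blast
    ultimately show "card ((\<lambda>x. H #> f x) ` carrier L) = card (rcosets H)" by simp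
  qed
  then have cover: "\<exists>x \<in> carrier L. f x \<otimes> inv g \<in> H" if g: "g \<in> carrier G" for g
  proof -
    have "H #> g \<in> (\<lambda>x. H #> f x) ` carrier L"
      using \<open>_ = rcosets H\<close> rcosetsI[OF H.subset g] by simp
    then obtain x where "x \<in> carrier L" "H #> f x = H #> g" by auto
    then show ?thesis using rcos_eq_iff[OF H f g] by blast
  qed
  have S: "?S \<in> NRT G H"
    unfolding NRT_iff[OF H]
  proof (intro conjI ballI)
    show "?S \<subseteq> carrier G" using f by blast
    show "\<one> \<in> ?S" using e by force
    fix g assume g: "g \<in> carrier G"
    obtain x where x: "x \<in> carrier L" "f x \<otimes> inv g \<in> H" using cover[OF g] by blast
    show "\<exists>!s. s \<in> ?S \<and> s \<otimes> inv g \<in> H"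
    proof (rule ex1I[of _ "f x"])
      fix t assume t: "t \<in> ?S \<and> t \<otimes> inv g \<in> H"
      then obtain y where y: "y \<in> carrier L" "t = f y" by blast
      have "(f y \<otimes> inv g) \<otimes> inv (f x \<otimes> inv g) \<in> H" using t y x by simp
      also have "(f y \<otimes> inv g) \<otimes> inv (f x \<otimes> inv g) = f y \<otimes> inv (f x)"
        using f[OF x(1)] f[OF y(1)] g by (simp add: inv_mult_group m_assoc mult_inv_cancel_left)
      finally show "t = f x" using inj x y by blast
    qed (use x in blast)
  qed
  have "f \<in> iso L (right_loop G H ?S)"
  proof (rule isoI, rule homI)
    fix x y assume xy: "x \<in> carrier L" "y \<in> carrier L"
    show "f (x \<otimes>\<^bsub>L\<^esub> y) = f x \<otimes>\<^bsub>right_loop G H ?S\<^esub> f y"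
      by (rule right_loop_eqI[OF H S, symmetric]) (use xy mult in auto)
  qed (use inj_f in \<open>simp_all add: bij_betw_def\<close>)
  then show ?thesis unfolding has_loop_def using S is_isoI by blast
qed

end

section \<open>Model loops of orders 2, 4 and 8\<close>

definition xor_group :: "bool monoid" where
  "xor_group = \<lparr>carrier = UNIV, monoid.mult = (\<noteq>), one = False\<rparr>"

definition klein_four :: "(bool \<times> bool) monoid" where
  "klein_four = \<lparr>carrier = UNIV, monoid.mult = (\<lambda>(a, x) (b, y). (a \<noteq> b, x \<noteq> y)), one = (False, False)\<rparr>"

text \<open>The pair \<open>(a, x)\<close> stands for rho^a sigma^x, where rho has order 4 and sigma
  is an involution inverting it.\<close>

definition dihedral8 :: "(int \<times> bool) monoid" where
  "dihedral8 = \<lparr>carrier = {0..3} \<times> UNIV,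
     monoid.mult = (\<lambda>(a, x) (b, y). ((a + (if x then - b else b)) mod 4, x \<noteq> y)), one = (0, False)\<rparr>"

text \<open>Any \<open>t\<close> outside \<open>H\<close> gives the transversal {1, t}, and t^2 lies
  in \<open>H\<close>.\<close>

lemma (in group) has_loop_index2:
  assumes fin: "finite (carrier G)" and H: "subgroup H G" "card H * 2 = order G"
  shows "has_loop H xor_group"
proof -
  have "H \<noteq> carrier G"
  proof
    assume "H = carrier G"
    then have "order G = 0" using H(2) unfolding order_def by simp
    then show False using fin order_gt_0_iff_finite by simp
  qed
  then obtain t where t: "t \<in> carrier G" "t \<notin> H" using subgroup.subset[OF H(1)] by blast
  have it: "inv t \<notin> H" using t subgroup.m_inv_closed[OF H(1)] inv_inv by metis
  have tt: "t \<otimes> t \<in> H" using subgroup_index2_mult[OF fin H t t] .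
  note 1 = subgroup.one_closed[OF H(1)]
  show ?thesis
  proof (rule has_loopI[OF fin H(1), where f = "\<lambda>b. if b then t else \<one>" and e = False])
    show "card (carrier xor_group) * card H = order G" using H(2) by (simp add: xor_group_def)
    fix x y :: bool
    show "(if x then t else \<one>) \<otimes> inv (if y then t else \<one>) \<in> H \<Longrightarrow> x = y"
      using t it by (cases x; cases y) simp_all
    show "(if x \<otimes>\<^bsub>xor_group\<^esub> y then t else \<one>) \<otimes> inv ((if x then t else \<one>) \<otimes> (if y then t else \<one>)) \<in> H"
      using t tt 1 subgroup.m_inv_closed[OF H(1) tt] by (cases x; cases y) (simp_all add: xor_group_def)
  qed (use t in \<open>auto simp: xor_group_def\<close>)
qed

text \<open>\<open>s = 0\<close> is the dihedral case, with b an involution, and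
  \<open>s = 4\<close> the dicyclic case, with b^2 = a^4.\<close>

locale dihedral_like = cyclic8_extension G E "-1" s for G (structure) and E s +
  assumes s: "s = 0 \<or> s = 4"
begin

lemma fin: "finite (carrier G)"
  using order_eq order_gt_0_iff_finite by simp

lemma E_inv: "inv (E m j) = E (if j then m + s else - m) j"
  using s by (intro inv_equality) (auto simp: E_mult E_one E_eq)

text \<open>The first case is the subgroup generated by a^2, the second the one generated by a^4 and
  a^i b. If some a^i b lies in \<open>H\<close>, the point is to find a^4 in
  \<open>H\<close>.\<close>

lemma card4_subgroup_cases:
  assumes H: "subgroup H G" "card H = 4"
  obtains "\<And>m j. E m j \<in> H \<longleftrightarrow> \<not> j \<and> even m"
  | i where "\<And>m j. E m j \<in> H \<longleftrightarrow> 4 dvd m - (if j then i else 0)"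
proof -
  interpret HG: group "G\<lparr>carrier := H\<rparr>" using subgroup_imp_group[OF H(1)] .
  note one = subgroup.one_closed[OF H(1), unfolded E_one]
  note closed = subgroup.m_closed[OF H(1)]
  have fH: "finite H" using H(2) card.infinite by fastforce
  \<comment> \<open>Elements of \<open>H\<close> have order dividing 4, which odd powers of a do
    not.\<close>
  have even: "even m" if m: "E m False \<in> H" for m
  proof -
    have "E m False [^]\<^bsub>G\<lparr>carrier := H\<rparr>\<^esub> (4::nat) = \<one>"
      using HG.pow_order_eq_1[of "E m False"] m H(2) by (simp add: order_def)
    then have "E m False [^] (4::nat) = \<one>" by (simp flip: nat_pow_consistent)
    then have "E (4 * m) False = E 0 False" by (simp add: numeral_eq_Suc E_mult E_one)
    then show ?thesis by (simp add: E_eq) presburger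
  qed
  show thesis
  proof (cases "\<exists>i. E i True \<in> H")
    case False
    have "H \<subseteq> {E 0 False, E 2 False, E 4 False, E 6 False}"
    proof
      fix h assume h: "h \<in> H"
      then obtain m j where m: "h = E m j" using E_surj subgroup.mem_carrier[OF H(1)] by blast
      then have "\<not> j" "even m" using h False even by (cases j; auto)+
      then show "h \<in> {E 0 False, E 2 False, E 4 False, E 6 False}"
        unfolding m by (simp add: E_eq) presburger
    qed
    moreover have "card {E 0 False, E 2 False, E 4 False, E 6 False} = 4" by (simp add: E_eq)
    ultimately have "H = {E 0 False, E 2 False, E 4 False, E 6 False}"
      using H(2) by (intro card_subset_eq) auto
    then have "E m j \<in> H \<longleftrightarrow> \<not> j \<and> even m" for m j
      by (cases j) (simp_all add: E_eq, presburger)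
    then show thesis using that(1) by blast
  next
    case True
    then obtain i where i: "E i True \<in> H" by blast
    \<comment> \<open>A nontrivial power of a in \<open>H\<close> has even exponent, so it or its
      square is a^4.\<close>
    have four: "E 4 False \<in> H" if m: "E m False \<in> H" "\<not> 8 dvd m" for m
    proof (cases "4 dvd m")
      case True
      then have "E m False = E 4 False" using m(2) by (simp add: E_eq) presburger
      then show ?thesis using m by simp
    next
      case False
      then have "E m False \<otimes> E m False = E 4 False" using even[OF m(1)] by (simp add: E_mult E_eq) presburger
      then show ?thesis using closed[OF m(1) m(1)] by simp
    qed
    \<comment> \<open>In the dicyclic case a^4 is the square of a^i b. In the dihedral case
      \<open>H\<close> has a third element, and either it or its product with a^i b is a nontrivial
      power of a.\<close>
    have E4: "E 4 False \<in> H"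
    proof (cases "s = 4")
      case True
      then show ?thesis using closed[OF i i] by (simp add: E_mult)
    next
      case False
      then have s0: "s = 0" using s by blast
      have "card {E 0 False, E i True} < card H" using H(2) by (simp add: E_eq)
      then have "\<not> H \<subseteq> {E 0 False, E i True}" using card_mono[of "{E 0 False, E i True}" H] by auto
      then obtain h where h: "h \<in> H" "h \<noteq> E 0 False" "h \<noteq> E i True" by blast
      then obtain m j where m: "h = E m j" using E_surj subgroup.mem_carrier[OF H(1)] by blast
      show ?thesis
      proof (cases j)
        case True
        have "h \<otimes> E i True = E (m - i) False" unfolding m using True s0 by (simp add: E_mult)
        then have "E (m - i) False \<in> H" using closed[OF h(1) i] by simp
        moreover have "\<not> 8 dvd m - i" using h(3) True unfolding m by (simp add: E_eq)
        ultimately show ?thesis by (rule four)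
      next
        case False
        then show ?thesis using four[of m] h(1,2) unfolding m by (simp add: E_eq)
      qed
    qed
    have "E (i + 4) True \<in> H" using closed[OF E4 i] by (simp add: E_mult add.commute)
    then have "{E 0 False, E 4 False, E i True, E (i + 4) True} \<subseteq> H" using one E4 i by blast
    moreover have "card {E 0 False, E 4 False, E i True, E (i + 4) True} = 4" by (simp add: E_eq)
    ultimately have "{E 0 False, E 4 False, E i True, E (i + 4) True} = H"
      using H(2) fH by (intro card_subset_eq) auto
    then have "E m j \<in> H \<longleftrightarrow> E m j \<in> {E 0 False, E 4 False, E i True, E (i + 4) True}" for m j by simp
    moreover have "4 dvd x \<longleftrightarrow> 8 dvd x \<or> 8 dvd x - 4" for x :: int by presburger
    ultimately have "E m j \<in> H \<longleftrightarrow> 4 dvd m - (if j then i else 0)" for m j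
      by (cases j) (simp_all add: E_eq diff_diff_eq)
    then show thesis using that(2) by blast
  qed
qed

text \<open>In the first case \<open>H\<close> is normal with Klein quotient. In the second the
  representatives come from the subgroup generated by a^2 and a^(i+1) b, which meets
  \<open>H\<close> in {1, a^4} and becomes a Klein four-group modulo a^4.\<close>

lemma card4_has_loop:
  assumes H: "subgroup H G" "card H = 4"
  shows "has_loop H klein_four"
proof -
  have c: "card (carrier klein_four) * card H = order G"
    using H(2) order_eq 
    by (simp add: klein_four_def card_cartesian_product flip: UNIV_Times_UNIV)
  show ?thesis
    using H
  proof (cases rule: card4_subgroup_cases)
    case 1
    show ?thesis
    proof (rule has_loopI[OF fin H(1) _ c, where f = "\<lambda>(a, x). E (if a then 1 else 0) x" and e = "(False, False)"])
      fix p q :: "bool \<times> bool"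
      obtain a x b y where pq: "p = (a, x)" "q = (b, y)" by (cases p; cases q) auto
      show "(case p of (a, x) \<Rightarrow> E (if a then 1 else 0) x) \<otimes> inv (case q of (a, x) \<Rightarrow> E (if a then 1 else 0) x) \<in> H \<Longrightarrow> p = q"
        using s by (cases a; cases b; cases x; cases y) (auto simp: pq E_inv E_mult 1)
      show "(case p \<otimes>\<^bsub>klein_four\<^esub> q of (a, x) \<Rightarrow> E (if a then 1 else 0) x) \<otimes>
          inv ((case p of (a, x) \<Rightarrow> E (if a then 1 else 0) x) \<otimes> (case q of (a, x) \<Rightarrow> E (if a then 1 else 0) x)) \<in> H"
        using s by (cases a; cases b; cases x; cases y) (auto simp: pq E_inv E_mult 1 klein_four_def)
    qed (auto simp: klein_four_def E_one)
  next
    case (2 i)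
    \<comment> \<open>The shift by one puts a^(i+1) b and a^(i+3) b into the cosets of odd powers of
      a, away from those of 1 and a^2.\<close>
    let ?f = "\<lambda>(a, x). E ((if a then 2 else 0) + (if x then i + 1 else 0)) x"
    show ?thesis
    proof (rule has_loopI[OF fin H(1) _ c, where f = ?f and e = "(False, False)"])
      fix p q :: "bool \<times> bool"
      obtain a x b y where pq: "p = (a, x)" "q = (b, y)" by (cases p; cases q) auto
      show "?f p \<otimes> inv (?f q) \<in> H \<Longrightarrow> p = q"
        using s by (cases a; cases b; cases x; cases y) (auto simp: pq E_inv E_mult 2)
      show "?f (p \<otimes>\<^bsub>klein_four\<^esub> q) \<otimes> inv (?f p \<otimes> ?f q) \<in> H"
        using s by (cases a; cases b; cases x; cases y) (auto simp: pq E_inv E_mult 2 klein_four_def)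
    qed (auto simp: klein_four_def E_one)
  qed
qed

lemma card2_subgroup:
  assumes H: "subgroup H G" "card H = 2"
  obtains t where "t \<in> carrier G" "t \<noteq> \<one>" "t \<otimes> t = \<one>" "H = {\<one>, t}"
proof -
  obtain x y where xy: "H = {x, y}" "x \<noteq> y" using H(2) by (auto simp: card_2_iff)
  then obtain t where t: "H = {\<one>, t}" "t \<noteq> \<one>" using subgroup.one_closed[OF H(1)] by auto
  then have tc: "t \<in> carrier G" using subgroup.subset[OF H(1)] by blast
  have "t \<otimes> t \<in> {\<one>, t}" using subgroup.m_closed[OF H(1), of t t] t by blast
  then have "t \<otimes> t = \<one>" using tc t(2) by auto
  then show thesis using that t tc by blast
qed

text \<open>For \<open>s = 4\<close> every a^m b has square a^4, so an involution must be a power of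
  a.\<close>

lemma card2_unique:
  assumes s4: "s = 4" and H: "subgroup H G" "card H = 2"
  shows "H = {\<one>, E 4 False}"
proof -
  obtain t where t: "t \<in> carrier G" "t \<noteq> \<one>" "t \<otimes> t = \<one>" "H = {\<one>, t}"
    using card2_subgroup[OF H] by blast
  obtain m j where m: "t = E m j" using E_surj[OF t(1)] by blast
  have "\<not> j" using t(3) s4 unfolding m by (auto simp: E_mult E_one E_eq)
  then have "E m j = E 4 False" using t(2,3) unfolding m by (simp add: E_mult E_one E_eq) presburger
  then show ?thesis using t(4) m by simp
qed

text \<open>The subgroup generated by a^4 is normal with dihedral quotient. If \<open>H\<close> is
  generated by some a^i b, then a^2 and a^(i+1) b generate a dihedral complement, whose elements
  serve as representatives.\<close>

lemma card2_has_loop: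
  assumes s0: "s = 0" and H: "subgroup H G" "card H = 2"
  shows "has_loop H dihedral8"
proof -
  obtain t where t: "t \<in> carrier G" "t \<noteq> \<one>" "t \<otimes> t = \<one>" "H = {\<one>, t}"
    using card2_subgroup[OF H] by blast
  obtain i l where i: "t = E i l" using E_surj[OF t(1)] by blast
  have c: "card (carrier dihedral8) * card H = order G"
    using H(2) order_eq by (simp add: dihedral8_def card_cartesian_product)
  \<comment> \<open>Writing the remainder as a difference with a multiple of 4 leaves linear
    divisibility goals when products in the model are checked.\<close>
  have div: "\<exists>q. z mod 4 = z - 4 * q" for z :: int
    by (metis minus_mult_div_eq_mod)
  have L: "carrier dihedral8 = {0..3} \<times> UNIV"
    "(a, x) \<otimes>\<^bsub>dihedral8\<^esub> (b, y) = ((a + (if x then - b else b)) mod 4, x \<noteq> y)" for a b x y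
    by (simp_all add: dihedral8_def)
  show ?thesis
  proof (cases l)
    case False
    then have "E i False = E 4 False" using t(2,3) unfolding i by (simp add: E_mult E_one E_eq) presburger
    then have mem: "E m j \<in> H \<longleftrightarrow> \<not> j \<and> 4 dvd m" for m j
      using False unfolding t(4) i by (cases j) (simp_all add: E_one E_eq, presburger)
    show ?thesis
    proof (rule has_loopI[OF fin H(1) _ c, where f = "\<lambda>(a, x). E a x" and e = "(0, False)"])
      fix p q assume "p \<in> carrier dihedral8" "q \<in> carrier dihedral8"
      then obtain a x b y where pq: "p = (a, x)" "q = (b, y)" "a \<in> {0..3}" "b \<in> {0..3}"
        by (cases p; cases q) (auto simp: L)
      show "p = q" if "(case p of (a, x) \<Rightarrow> E a x) \<otimes> inv (case q of (a, x) \<Rightarrow> E a x) \<in> H"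
      proof -
        have xy: "x = y" "4 dvd a - b"
          using that s0 by (cases x; cases y; simp add: pq E_inv E_mult mem)+
        then have "a = b" using pq(3,4) unfolding atLeastAtMost_iff by presburger
        then show ?thesis using xy pq by simp
      qed
      obtain r where r: "(a + (if x then - b else b)) mod 4 = a + (if x then - b else b) - 4 * r"
        using div by blast
      show "(case p \<otimes>\<^bsub>dihedral8\<^esub> q of (a, x) \<Rightarrow> E a x) \<otimes>
          inv ((case p of (a, x) \<Rightarrow> E a x) \<otimes> (case q of (a, x) \<Rightarrow> E a x)) \<in> H"
        using s0 unfolding pq L r by (cases x; cases y) (simp_all add: E_inv E_mult mem)
    qed (auto simp: L E_one)
  next
    case True
    have mem: "E m j \<in> H \<longleftrightarrow> 8 dvd m - (if j then i else 0)" for m j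
      using True unfolding t(4) i by (simp add: E_one E_eq)
    let ?f = "\<lambda>(a, x). E (2 * a + (if x then i + 1 else 0)) x"
    show ?thesis
    proof (rule has_loopI[OF fin H(1) _ c, where f = ?f and e = "(0, False)"])
      fix p q assume "p \<in> carrier dihedral8" "q \<in> carrier dihedral8"
      then obtain a x b y where pq: "p = (a, x)" "q = (b, y)" "a \<in> {0..3}" "b \<in> {0..3}"
        by (cases p; cases q) (auto simp: L)
      show "p = q" if "?f p \<otimes> inv (?f q) \<in> H"
      proof -
        have xy: "x = y \<and> 8 dvd 2 * a - 2 * b"
          using that s0 by (cases x; cases y) (simp_all add: pq E_inv E_mult mem, presburger+)
        have "a = b" using conjunct2[OF xy] pq(3,4) unfolding atLeastAtMost_iff by presburger
        then show ?thesis using xy pq by simp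
      qed
      obtain r where r: "(a + (if x then - b else b)) mod 4 = a + (if x then - b else b) - 4 * r"
        using div by blast
      show "?f (p \<otimes>\<^bsub>dihedral8\<^esub> q) \<otimes> inv (?f p \<otimes> ?f q) \<in> H"
        using s0 unfolding pq L r by (cases x; cases y) (simp_all add: E_inv E_mult mem algebra_simps)
    qed (auto simp: L E_one)
  qed
qed

lemma t_group: "t_group G"
  unfolding t_group_iff
proof (intro conjI allI impI)
  fix H K assume "subgroup H G \<and> subgroup K G \<and> card H = card K \<and> H \<noteq> K"
  then have H: "subgroup H G" and K: "subgroup K G" "card K = card H" and ne: "H \<noteq> K" by auto
  have "card H dvd 16" using lagrange_finite[OF fin H] order_eq by (metis dvd_triv_right)
  then have "card H dvd 2 ^ 4" by simp
  then obtain n where n: "n \<le> 4" "card H = 2 ^ n"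
    using divides_primepow_nat[OF two_is_prime_nat] by blast
  have one: "\<one> \<in> H" "\<one> \<in> K" using H K subgroup.one_closed by blast+
  have sub: "H \<subseteq> carrier G" "K \<subseteq> carrier G" using H K subgroup.subset by blast+
  have "n \<noteq> 0"
  proof
    assume "n = 0"
    then have "card H = 1" "card K = 1" using n K by auto
    then have "H = {\<one>}" "K = {\<one>}" using one by (auto simp: card_1_singleton_iff)
    then show False using ne by simp
  qed
  moreover have "n \<noteq> 4"
  proof
    assume "n = 4"
    then have "card H = card (carrier G)" "card K = card (carrier G)"
      using n K order_eq by (auto simp: order_def)
    then have "H = carrier G" "K = carrier G" using card_subset_eq[OF fin] sub by auto
    then show False using ne by simp
  qed
  ultimately consider "n = 1" | "n = 2" | "n = 3" using n(1) by linarith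
  then show "\<exists>S\<in>NRT G H. \<exists>T\<in>NRT G K. right_loop G H S \<cong> right_loop G K T"
  proof cases
    case 1
    then have c: "card H = 2" "card K = 2" using n K by auto
    \<comment> \<open>For \<open>s = 4\<close> both subgroups would be {1, a^4}, contrary to their
      being distinct.\<close>
    then have "s = 0" using card2_unique[of H] card2_unique[of K] H K ne s by auto
    then have "has_loop H dihedral8" "has_loop K dihedral8" using card2_has_loop H K c by auto
    then show ?thesis by (rule has_loop_common) (auto simp: dihedral8_def)
  next
    case 2
    then have "has_loop H klein_four" "has_loop K klein_four" using card4_has_loop H K n by auto
    then show ?thesis by (rule has_loop_common) (auto simp: klein_four_def)
  next
    case 3
    then have "has_loop H xor_group" "has_loop K xor_group"
      using has_loop_index2[OF fin H] has_loop_index2[OF fin K(1)] order_eq K(2) n by auto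
    then show ?thesis by (rule has_loop_common) (auto simp: xor_group_def)
  qed
qed (simp_all add: fin)

end

theorem proposition4p1:
  fixes G :: "('a, 'b) monoid_scheme"
  assumes "group G"
    and "order G = 16"
    and "\<not> comm_group G"
  shows "t_group G \<longleftrightarrow> (G \<cong> D16 \<or> G \<cong> Q16)"
proof -
  interpret group G by fact
  have noncomm: "\<exists>g\<in>carrier G. \<exists>h\<in>carrier G. g \<otimes>\<^bsub>G\<^esub> h \<noteq> h \<otimes>\<^bsub>G\<^esub> g"
    using assms(3) group_comm_groupI by blast
  have D16: "G \<cong> D16 \<longleftrightarrow> (\<exists>E. cyclic8_extension G E (-1) 0)"
    using iso_presented_iff[OF assms(1,2), of 0] by (simp add: D16_eq)
  have Q16: "G \<cong> Q16 \<longleftrightarrow> (\<exists>E. cyclic8_extension G E (-1) 4)"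
    using iso_presented_iff[OF assms(1,2), of 4] by (simp add: Q16_eq)
  have "t_group G" if "cyclic8_extension G E (-1) s" "s = 0 \<or> s = 4" for E s
    by (rule dihedral_like.t_group) (use that in \<open>simp add: dihedral_like_def dihedral_like_axioms_def\<close>)
  then show ?thesis
    unfolding D16 Q16 using t_group_cyclic8_extension[OF _ assms(2) noncomm] by blast
qed

end
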